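(* Let $b,c\in\mathbb R$ satisfy $b>-1$, $0\le 2-c+b<1$ and $c=1$. Then the following hold. (i) $S_{-1,b,c}$ is unbounded from $L^{\frac{1}{b+1},1}(\mathbb D)$ to $L^{1,\infty}(\mathbb D)$. (ii) $T_{-1,b,c}$ is bounded from $L^{\frac{1}{b+1},1}(\mathbb D)$ to $L^{1,\infty}(\mathbb D)$.
   Context: $\mathbb D$ is the open unit disc in $\mathbb C$, $dA$ is normalized area measure on $\mathbb D$, and $|E|$ is the $dA$-measure of $E\subseteq\mathbb D$. For $a,b,c\in\mathbb R$, $$T_{a,b,c}f(z):=(1-|z|^2)^a\int_{\mathbb D}\frac{(1-|w|^2)^b}{(1-z\overline w)^c}f(w)\,dA(w),\qquad S_{a,b,c}f(z):=(1-|z|^2)^a\int_{\mathbb D}\frac{(1-|w|^2)^b}{|1-z\overline w|^c}f(w)\,dA(w),$$ with the principal branch of the power; here $a=-1$. $\|f\|_{L^{1,\infty}}=\sup_{\lambda>0}\lambda|\{|f|>\lambda\}|$; for $1\le p<\infty$, $\|f\|_{L^{p,1}}=p\int_0^\infty|\{|f|>\lambda\}|^{1/p}\,d\lambda$. An operator $\mathcal T$ is bounded from $X$ to $Y$ if for every $f\in X$ the defining integral converges absolutely for a.e. $z$ and $\|\mathcal Tf\|_Y\le C\|f\|_X$ with $C$ independent of $f$; otherwise it is unbounded from $X$ to $Y$. *)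

theory Defs
  imports "HOL-Analysis.Analysis"
begin

definition disc_measure :: "complex measure" where
  "disc_measure = density (lebesgue_on (ball 0 1)) (\<lambda>_. ennreal (1 / pi))"

text \<open>Quasi-norms are extended-valued functionals on functions defined on the disc (values off
  \<open>ball 0 1\<close> are irrelevant); the space given by \<open>N\<close> consists of the Lebesgue measurable functions
  on the disc with finite \<open>N\<close>.  Functions agreeing almost everywhere are not identified, which makes
  no difference because all notions below are invariant under changes on null sets.\<close>

definition distribution_fun :: "(complex \<Rightarrow> complex) \<Rightarrow> real \<Rightarrow> ennreal" where
  "distribution_fun f t = emeasure disc_measure {z \<in> ball 0 1. cmod (f z) > t}"

definition weak_L1_norm :: "(complex \<Rightarrow> complex) \<Rightarrow> ennreal" where
  "weak_L1_norm f = (SUP t\<in>{0<..}. ennreal t * distribution_fun f t)"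

text \<open>The distribution function is at most 1, so passing to \<^term>\<open>enn2real\<close> loses nothing.\<close>

definition lorentz_p1_norm :: "real \<Rightarrow> (complex \<Rightarrow> complex) \<Rightarrow> ennreal" where
  "lorentz_p1_norm p f =
     ennreal p * (\<integral>\<^sup>+ t\<in>{0<..}. ennreal (enn2real (distribution_fun f t) powr (1 / p)) \<partial>lborel)"

definition disc_space :: "((complex \<Rightarrow> complex) \<Rightarrow> ennreal) \<Rightarrow> (complex \<Rightarrow> complex) set" where
  "disc_space N = {f \<in> borel_measurable disc_measure. N f < \<infinity>}"

definition T_kernel :: "real \<Rightarrow> real \<Rightarrow> complex \<Rightarrow> complex \<Rightarrow> complex" where
  "T_kernel b c z w =
     complex_of_real ((1 - (cmod w)\<^sup>2) powr b) / (1 - z * cnj w) powr complex_of_real c"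

definition S_kernel :: "real \<Rightarrow> real \<Rightarrow> complex \<Rightarrow> complex \<Rightarrow> complex" where
  "S_kernel b c z w =
     complex_of_real ((1 - (cmod w)\<^sup>2) powr b / cmod (1 - z * cnj w) powr c)"

text \<open>With \<open>K = T_kernel b c\<close> and \<open>K = S_kernel b c\<close> this is the operator \<open>T\<^bsub>a,b,c\<^esub>\<close>
  and \<open>S\<^bsub>a,b,c\<^esub>\<close>, respectively.  It takes a junk value at those \<open>z\<close> where the integral does
  not converge absolutely; boundedness below requires these \<open>z\<close> to form a null set.\<close>

definition disc_operator ::
    "real \<Rightarrow> (complex \<Rightarrow> complex \<Rightarrow> complex) \<Rightarrow> (complex \<Rightarrow> complex) \<Rightarrow> complex \<Rightarrow> complex" where
  "disc_operator a K f z =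
     complex_of_real ((1 - (cmod z)\<^sup>2) powr a) * (\<integral>w. K z w * f w \<partial>disc_measure)"

definition bounded_disc_operator ::
    "real \<Rightarrow> (complex \<Rightarrow> complex \<Rightarrow> complex) \<Rightarrow>
     ((complex \<Rightarrow> complex) \<Rightarrow> ennreal) \<Rightarrow> ((complex \<Rightarrow> complex) \<Rightarrow> ennreal) \<Rightarrow> bool" where
  "bounded_disc_operator a K N\<^sub>X N\<^sub>Y \<longleftrightarrow>
     (\<exists>C::real. C \<ge> 0 \<and>
       (\<forall>f\<in>disc_space N\<^sub>X.
          (AE z in disc_measure. integrable disc_measure (\<lambda>w. K z w * f w)) \<and>
          disc_operator a K f \<in> disc_space N\<^sub>Y \<and>
          N\<^sub>Y (disc_operator a K f) \<le> ennreal C * N\<^sub>X f))"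

end

theory Submission
  imports Defs "HOL-Complex_Analysis.Complex_Analysis"
begin

text \<open>Write \<open>h(z) = 1 - |z|\<^sup>2\<close> and \<open>p = 1/(b+1)\<close>.  The image of the measure under \<open>h\<close> is
  uniform on \<open>(0,1)\<close>, and integrals over the disc may be averaged over rotations.

  For \<open>S\<close>, test on the indicator of the annulus \<open>h < m\<close>, whose norm is a multiple of \<open>m powr (b+1)\<close>:
  where \<open>h(z) \<ge> m\<close>, the circle means of \<open>1/|1 - z cnj w|\<close> give
  \<open>S f (z) \<ge> const * m powr (b+1) * ln (1/h(z)) / h(z)\<close>, and the logarithm breaks the estimate as \<open>m \<rightarrow> 0\<close>.

  For \<open>T\<close> and \<open>f \<ge> 0\<close>, fix \<open>1 < q < min 2 p\<close>.  Splitting each level set of \<open>f\<close> of measure \<open>m\<close> at height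
  \<open>h = m\<close> shows that the Poisson-type integral of \<open>f * h powr b\<close> has \<open>L\<^sup>q\<close> means over circles
  bounded by the \<open>L\<close>-\<open>(p,1)\<close> norm of \<open>f\<close>.  It is the positive real part of \<open>2 F - F(0)\<close>, where \<open>F\<close> is
  the Cauchy transform of \<open>f * h powr b\<close>, so the classical proof of M. Riesz's theorem bounds the \<open>L\<^sup>q\<close> means
  of \<open>F\<close> as well.  Because \<open>q > 1\<close>, Chebyshev's inequality on each circle is integrable
  in the radius and yields the weak-type bound for \<open>F/h\<close> without any maximal function.\<close>

section \<open>Rotations and radial integration\<close>

text \<open>The factor \<open>1/h\<close> shapes both halves: it lies in weak \<open>L^1\<close> but
  not in \<open>L^1\<close>, so a logarithmic loss in the inner integral is fatal. Modulus kernels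
  do have circle means of logarithmic size, hence the cancellation in the holomorphic kernel must be
  used before absolute values are taken; the Poisson kernel retains it, all its circle means being
  1. The same obstacle excludes \<open>q = 1\<close>: Chebyshev's bound at height \<open>x\<close>
  would be a multiple of \<open>1/x\<close>, whereas \<open>q > 1\<close> gives
  \<open>x powr - q\<close>, which is integrable away from 0. The upper limits on \<open>q\<close>
  have two origins. The angles \<open>q * pi / 2\<close> must stay below \<open>pi\<close> in
  Riesz's argument. And with the conjugate exponent \<open>\<sigma>\<close>, Hoelder's inequality
  leaves the integral of \<open>h powr (b * \<sigma>)\<close> over \<open>h \<ge> m\<close>, which
  has the right scaling in \<open>m\<close> when \<open>b * \<sigma> < -1\<close>, that is
  \<open>q < p\<close>. The second Lorentz index 1 comes from the level sets: one of measure
  \<open>m\<close> costs \<open>m powr (b + 1)\<close>, the mass that \<open>h powr b\<close> gives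
  to the annulus \<open>h < m\<close> up to a constant, and the norm adds exactly these costs over
  all levels.\<close>

text \<open>The image measure is translation invariant, and comparing it with \<open>lborel\<close> through a double
  integral over \<open>A\<close> and \<open>B\<close> identifies the two measures, the factor being fixed by the unit ball.\<close>

lemma distr_lborel_orthogonal_transformation:
  fixes T :: "'a::euclidean_space \<Rightarrow> 'a"
  assumes T: "orthogonal_transformation T"
  shows "distr lborel borel T = lborel"
proof -
  define N where "N = distr lborel borel T"
  have lin: "linear T" and norm_T: "\<And>x. norm (T x) = norm x"
    using T by (auto simp: orthogonal_transformation)
  have surj: "surj T"
    using T by (rule orthogonal_transformation_surj)
  have [measurable]: "T \<in> borel_measurable borel"
    using lin by (intro borel_measurable_continuous_onI linear_continuous_on) (simp add: linear_linear)
  have sets_N [measurable_cong, simp]: "sets N = sets borel"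
    by (simp add: N_def)
  have space_N [simp]: "space N = UNIV"
    by (simp add: N_def)
  have ball_N: "emeasure N (ball 0 r) = emeasure lborel (ball (0::'a) r)" for r
  proof -
    have "T -` ball 0 r = ball 0 r"
      by (auto simp: norm_T)
    then show ?thesis
      by (simp add: N_def emeasure_distr)
  qed
  \<comment> \<open>Tonelli needs \<open>N\<close> to be sigma-finite, which the invariance of balls
    supplies.\<close>
  interpret N: sigma_finite_measure N
  proof
    show "\<exists>A. countable A \<and> A \<subseteq> sets N \<and> \<Union> A = space N \<and> (\<forall>a\<in>A. emeasure N a \<noteq> \<infinity>)"
    proof (intro exI conjI ballI)
      show "countable (range (\<lambda>n::nat. ball (0::'a) (real n)))" by simp
      show "range (\<lambda>n::nat. ball (0::'a) (real n)) \<subseteq> sets N" by auto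
      show "\<Union> (range (\<lambda>n::nat. ball (0::'a) (real n))) = space N"
        using reals_Archimedean2 by auto
    next
      fix a assume "a \<in> range (\<lambda>n::nat. ball (0::'a) (real n))"
      then obtain n where "a = ball 0 (real n)" by auto
      then show "emeasure N a \<noteq> \<infinity>"
        using emeasure_lborel_ball_finite[of "0::'a" "real n"] ball_N[of "real n"] by simp
    qed
  qed
  interpret P: pair_sigma_finite N lborel ..
  have shift_N: "(\<integral>\<^sup>+y. f (c + y) \<partial>N) = (\<integral>\<^sup>+y. f y \<partial>N)"
    if [measurable]: "f \<in> borel_measurable borel" for f and c :: 'a
  proof -
    obtain d where d: "c = T d" using surj by auto
    have "(\<integral>\<^sup>+y. f (c + y) \<partial>N) = (\<integral>\<^sup>+x. f (T (d + x)) \<partial>lborel)"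
      by (simp add: N_def nn_integral_distr d linear_add[OF lin])
    also have "\<dots> = (\<integral>\<^sup>+x. f (T x) \<partial>distr lborel borel ((+) d))"
      by (subst nn_integral_distr) auto
    also have "\<dots> = (\<integral>\<^sup>+y. f y \<partial>N)"
      by (simp add: lborel_distr_plus N_def nn_integral_distr)
    finally show ?thesis .
  qed
  have shift_l: "(\<integral>\<^sup>+x. f x \<partial>lborel) = (\<integral>\<^sup>+x. f (x - c) \<partial>lborel)"
    if [measurable]: "f \<in> borel_measurable borel" for f and c :: 'a
  proof -
    have "(\<integral>\<^sup>+x. f x \<partial>lborel) = (\<integral>\<^sup>+x. f x \<partial>distr lborel borel ((+) (-c)))"
      by (simp add: lborel_distr_plus)
    also have "\<dots> = (\<integral>\<^sup>+x. f (x - c) \<partial>lborel)"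
      by (subst nn_integral_distr) auto
    finally show ?thesis .
  qed
  let ?A = "ball (0::'a) 1"
  have [measurable]: "?A \<in> sets borel" by simp
  have "N = lborel"
  proof (rule measure_eqI)
    fix B assume "B \<in> sets N"
    then have [measurable]: "B \<in> sets borel" by simp
    have "emeasure lborel ?A * emeasure N B
        = (\<integral>\<^sup>+x. indicator ?A x * (\<integral>\<^sup>+y. indicator B (x + y) \<partial>N) \<partial>lborel)"
      by (subst shift_N, simp, subst nn_integral_multc) auto
    also have "\<dots> = (\<integral>\<^sup>+x. \<integral>\<^sup>+y. indicator ?A x * indicator B (x + y) \<partial>N \<partial>lborel)"
      by (intro nn_integral_cong) (simp add: nn_integral_cmult)
    also have "\<dots> = (\<integral>\<^sup>+y. \<integral>\<^sup>+x. indicator ?A x * indicator B (x + y) \<partial>lborel \<partial>N)"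
      by (rule P.Fubini') simp
    also have "\<dots> = (\<integral>\<^sup>+y. \<integral>\<^sup>+x. indicator ?A (x - y) * indicator B x \<partial>lborel \<partial>N)"
    proof (rule nn_integral_cong)
      fix y :: 'a
      show "(\<integral>\<^sup>+x. indicator ?A x * indicator B (x + y) \<partial>lborel)
          = (\<integral>\<^sup>+x. indicator ?A (x - y) * indicator B x \<partial>lborel)"
        by (subst shift_l[of _ y]) auto
    qed
    also have "\<dots> = (\<integral>\<^sup>+x. \<integral>\<^sup>+y. indicator ?A (x - y) * indicator B x \<partial>N \<partial>lborel)"
      by (rule P.Fubini'[symmetric]) simp
    also have "\<dots> = (\<integral>\<^sup>+x. (\<integral>\<^sup>+y. indicator ?A ((-x) + y) \<partial>N) * indicator B x \<partial>lborel)"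
      by (intro nn_integral_cong)
         (auto simp: nn_integral_multc[symmetric] indicator_def norm_minus_commute intro!: nn_integral_cong)
    also have "\<dots> = emeasure N ?A * emeasure lborel B"
      by (subst shift_N) (auto simp: nn_integral_cmult)
    finally have eq: "emeasure lborel ?A * emeasure N B = emeasure lborel ?A * emeasure lborel B"
      by (simp add: ball_N)
    moreover have "emeasure lborel ?A \<noteq> 0" "emeasure lborel ?A \<noteq> \<infinity>"
      using less_imp_neq[OF unit_ball_vol_pos[of "real DIM('a)"]] by (simp_all add: emeasure_ball)
    ultimately show "emeasure N B = emeasure lborel B"
      by (simp add: ennreal_mult_cancel_left)
  qed simp
  then show ?thesis by (simp add: N_def)
qed

section \<open>Height, area and rotations of the disc\<close>

definition disc_height :: "complex \<Rightarrow> real" where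
  "disc_height z = 1 - (cmod z)\<^sup>2"

lemma disc_height_pos: "cmod z < 1 \<Longrightarrow> 0 < disc_height z"
  by (simp add: disc_height_def abs_square_less_1)

text \<open>Angles are measured in full turns, so that the angular measure is a probability measure.\<close>

definition turn_measure :: "real measure" where
  "turn_measure = density lborel (indicator {0..1})"

definition turn :: "real \<Rightarrow> complex" where
  "turn \<theta> = cis (2 * pi * \<theta>)"

lemma norm_turn [simp]: "cmod (turn \<theta>) = 1"
  by (simp add: turn_def)

lemma disc_height_turn [simp]: "disc_height (turn \<theta> * z) = disc_height z"
  by (simp add: disc_height_def norm_mult)

lemma measurable_turn [measurable]: "turn \<in> borel_measurable borel"
  unfolding turn_def by (intro borel_measurable_continuous_onI continuous_intros)

lemma measurable_disc_height [measurable]: "disc_height \<in> borel_measurable borel"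
  unfolding disc_height_def by measurable

lemma sets_turn_measure [measurable_cong, simp]: "sets turn_measure = sets borel"
  and space_turn_measure [simp]: "space turn_measure = UNIV"
  by (simp_all add: turn_measure_def)

lemma emeasure_turn_measure_UNIV [simp]: "emeasure turn_measure UNIV = 1"
  by (simp add: turn_measure_def emeasure_density)

interpretation turn_measure: finite_measure turn_measure
  by standard simp

lemma space_disc_measure [simp]: "space disc_measure = ball 0 1"
  by (simp add: disc_measure_def)

lemma sets_disc_measure: "sets disc_measure = sets (lebesgue_on (ball 0 1))"
  by (simp add: disc_measure_def)

lemma borel_measurable_disc_measure:
  "f \<in> borel_measurable borel \<Longrightarrow> f \<in> borel_measurable disc_measure"
  unfolding disc_measure_def
  by (simp add: measurable_restrict_space1 measurable_completion)

lemma id_measurable_disc_measure [measurable]: "(\<lambda>z. z) \<in> borel_measurable disc_measure"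
  by (rule borel_measurable_disc_measure) simp

lemma measurable_disc_height_disc [measurable]: "disc_height \<in> borel_measurable disc_measure"
  by (rule borel_measurable_disc_measure) simp

lemma sets_borel_unit_ball [measurable]: "ball (0::complex) 1 \<in> sets borel"
  by simp

lemma nn_integral_disc_measure:
  assumes [measurable]: "f \<in> borel_measurable borel"
  shows "(\<integral>\<^sup>+z. f z \<partial>disc_measure) = ennreal (1 / pi) * (\<integral>\<^sup>+z\<in>ball 0 1. f z \<partial>lborel)"
proof -
  have "(\<integral>\<^sup>+z. f z \<partial>disc_measure) = (\<integral>\<^sup>+z. ennreal (1 / pi) * f z \<partial>lebesgue_on (ball 0 1))"
    unfolding disc_measure_def
    by (subst nn_integral_density) (auto intro!: measurable_restrict_space1 measurable_completion)
  also have "\<dots> = (\<integral>\<^sup>+z. ennreal (1 / pi) * f z * indicator (ball 0 1) z \<partial>lebesgue)"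
    by (subst nn_integral_restrict_space) auto
  also have "\<dots> = (\<integral>\<^sup>+z. ennreal (1 / pi) * (f z * indicator (ball 0 1) z) \<partial>lborel)"
    by (subst nn_integral_completion) (auto simp: mult.assoc)
  also have "\<dots> = ennreal (1 / pi) * (\<integral>\<^sup>+z\<in>ball 0 1. f z \<partial>lborel)"
    by (rule nn_integral_cmult) simp
  finally show ?thesis .
qed

lemma emeasure_disc_measure:
  assumes [measurable]: "A \<in> sets borel"
  shows "emeasure disc_measure (A \<inter> ball 0 1) = ennreal (1 / pi) * emeasure lborel (A \<inter> ball 0 1)"
proof -
  have "A \<inter> ball 0 1 \<in> sets disc_measure"
    by (simp add: sets_disc_measure sets_restrict_space_iff)
  then have "emeasure disc_measure (A \<inter> ball 0 1) = (\<integral>\<^sup>+z. indicator (A \<inter> ball 0 1) z \<partial>disc_measure)"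
    by (rule nn_integral_indicator[symmetric])
  also have "\<dots> = ennreal (1 / pi) * (\<integral>\<^sup>+z\<in>ball 0 1. indicator (A \<inter> ball 0 1) z \<partial>lborel)"
    by (subst nn_integral_disc_measure) auto
  also have "(\<integral>\<^sup>+z\<in>ball 0 1. indicator (A \<inter> ball 0 1) z \<partial>lborel)
      = (\<integral>\<^sup>+z. indicator (A \<inter> ball 0 1) z \<partial>lborel)"
    by (intro nn_integral_cong) (auto simp: indicator_def)
  finally show ?thesis by simp
qed

lemma emeasure_disc_measure_ball:
  assumes "0 \<le> r" "r \<le> 1"
  shows "emeasure disc_measure (ball 0 r) = ennreal (r\<^sup>2)"
proof -
  have "emeasure disc_measure (ball 0 r \<inter> ball 0 1) = ennreal (1 / pi) * emeasure lborel (ball (0::complex) r \<inter> ball 0 1)"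
    by (rule emeasure_disc_measure) auto
  moreover have "ball (0::complex) r \<inter> ball 0 1 = ball 0 r" using assms by auto
  ultimately show ?thesis
    using assms by (simp add: emeasure_ball unit_ball_vol_2 ennreal_mult[symmetric])
qed

interpretation disc_measure: finite_measure disc_measure
  by standard (simp add: emeasure_disc_measure_ball)

lemma nn_integral_disc_turn:
  assumes [measurable]: "f \<in> borel_measurable borel" and w: "cmod w = 1"
  shows "(\<integral>\<^sup>+z. f (w * z) \<partial>disc_measure) = (\<integral>\<^sup>+z. f z \<partial>disc_measure)"
proof -
  have o: "orthogonal_transformation ((*) w)"
    by (auto simp: orthogonal_transformation norm_mult w intro!: linearI simp: algebra_simps)
  have "(\<integral>\<^sup>+z\<in>ball 0 1. f (w * z) \<partial>lborel)
      = (\<integral>\<^sup>+z. f (w * z) * indicator (ball 0 1) (w * z) \<partial>lborel)"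
    by (intro nn_integral_cong) (auto simp: indicator_def norm_mult w)
  also have "\<dots> = (\<integral>\<^sup>+z\<in>ball 0 1. f z \<partial>distr lborel borel ((*) w))"
    by (subst nn_integral_distr) auto
  finally show ?thesis
    by (simp add: nn_integral_disc_measure distr_lborel_orthogonal_transformation[OF o])
qed

interpretation turn_disc: pair_sigma_finite turn_measure disc_measure ..

text \<open>Replaces polar coordinates: the inner integral is a circle mean, and once it is
  expressed or bounded through \<open>disc_height z\<close>, the rest reduces to one variable by
  \<open>nn_integral_disc_height\<close>.\<close>

lemma nn_integral_disc_turn_average:
  assumes [measurable]: "f \<in> borel_measurable borel"
  shows "(\<integral>\<^sup>+z. f z \<partial>disc_measure) = (\<integral>\<^sup>+z. (\<integral>\<^sup>+\<theta>. f (turn \<theta> * z) \<partial>turn_measure) \<partial>disc_measure)"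
proof -
  have "(\<integral>\<^sup>+z. (\<integral>\<^sup>+\<theta>. f (turn \<theta> * z) \<partial>turn_measure) \<partial>disc_measure)
      = (\<integral>\<^sup>+\<theta>. (\<integral>\<^sup>+z. f (turn \<theta> * z) \<partial>disc_measure) \<partial>turn_measure)"
    by (rule turn_disc.Fubini') simp
  also have "\<dots> = (\<integral>\<^sup>+z. f z \<partial>disc_measure)"
    by (simp add: nn_integral_disc_turn)
  finally show ?thesis by simp
qed

text \<open>The height exceeds \<open>x\<close> in \<open>[0,1)\<close> on the disc of radius
  \<open>sqrt (1 - x)\<close>, of normalized area \<open>1 - x\<close>; the masses of half-lines
  determine the measure.\<close>

lemma distr_disc_height:
  "distr disc_measure borel disc_height = density lborel (indicator {0<..<1})"
proof (rule measure_eqI_lessThan)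
  fix x :: real
  show "emeasure (distr disc_measure borel disc_height) {x<..} < \<infinity>"
    using disc_measure.emeasure_finite by (auto simp: emeasure_distr less_top[symmetric])
  have "emeasure (distr disc_measure borel disc_height) {x<..}
      = emeasure disc_measure (disc_height -` {x<..} \<inter> ball 0 1)"
    by (simp add: emeasure_distr)
  also have "disc_height -` {x<..} \<inter> ball 0 1 = ball 0 (if x < 0 then 1 else if x < 1 then sqrt (1 - x) else 0)"
  proof (cases "x < 0")
    case True
    then show ?thesis
      by (auto simp: disc_height_def intro!: order.strict_trans[of x 0] simp: power_less_one_iff)
  next
    case False
    have eq: "cmod z < 1 \<and> x < 1 - (cmod z)\<^sup>2 \<longleftrightarrow> x < 1 \<and> cmod z < sqrt (1 - x)" for z
    proof safe
      assume "x < 1 - (cmod z)\<^sup>2"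
      then show "cmod z < sqrt (1 - x)" by (intro real_less_rsqrt) simp
      show "x < 1" using \<open>x < 1 - (cmod z)\<^sup>2\<close> zero_le_power2[of "cmod z"] by linarith
    next
      assume *: "x < 1" "cmod z < sqrt (1 - x)"
      show "cmod z < 1" by (rule order.strict_trans2[where b = "sqrt (1 - x)"]) (use *(2) False in simp_all)
      have "(cmod z)\<^sup>2 < (sqrt (1 - x))\<^sup>2" using * by (intro power_strict_mono) auto
      then show "x < 1 - (cmod z)\<^sup>2" using * by simp
    qed
    have "disc_height -` {x<..} \<inter> ball 0 1 = {z. cmod z < 1 \<and> x < 1 - (cmod z)\<^sup>2}"
      by (auto simp: disc_height_def)
    also have "\<dots> = ball 0 (if x < 0 then 1 else if x < 1 then sqrt (1 - x) else 0)"
      unfolding eq using False by auto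
    finally show ?thesis .
  qed
  also have "emeasure disc_measure \<dots> = emeasure lborel ({x<..} \<inter> {0<..<1})"
  proof -
    have "{x<..} \<inter> {0<..<1} = (if x < 0 then {0<..<1} else if x < 1 then {x<..<1} else {})"
      by auto
    then show ?thesis by (simp add: emeasure_disc_measure_ball)
  qed
  also have "\<dots> = emeasure (density lborel (indicator {0<..<1})) {x<..}"
  proof -
    have "emeasure lborel ({x<..} \<inter> {0<..<1}) = (\<integral>\<^sup>+y. indicator ({x<..} \<inter> {0<..<1}) y \<partial>lborel)"
      by (rule nn_integral_indicator[symmetric]) simp
    also have "\<dots> = (\<integral>\<^sup>+y. indicator {0<..<1} y * indicator {x<..} y \<partial>lborel)"
      by (intro nn_integral_cong) (auto simp: indicator_def)
    finally show ?thesis by (simp add: emeasure_density)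
  qed
  finally show "emeasure (distr disc_measure borel disc_height) {x<..}
      = emeasure (density lborel (indicator {0<..<1})) {x<..}" .
qed simp_all

lemma nn_integral_disc_height:
  assumes [measurable]: "f \<in> borel_measurable borel"
  shows "(\<integral>\<^sup>+z. f (disc_height z) \<partial>disc_measure) = (\<integral>\<^sup>+x\<in>{0<..<1}. f x \<partial>lborel)"
proof -
  have "(\<integral>\<^sup>+z. f (disc_height z) \<partial>disc_measure) = (\<integral>\<^sup>+x. f x \<partial>distr disc_measure borel disc_height)"
    by (subst nn_integral_distr) auto
  then show ?thesis
    by (simp add: distr_disc_height nn_integral_density mult.commute)
qed

section \<open>Mean values and the Riesz inequality\<close>

text \<open>Links the Lebesgue integral over turns with the gauge integral over
  \<open>{0..1}\<close>, in which contour integrals are expressed.\<close>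

lemma integrable_turn_measure:
  fixes h :: "complex \<Rightarrow> 'b::euclidean_space"
  assumes h: "continuous_on (ball 0 1) h" and z: "cmod z < 1"
  shows "integrable turn_measure (\<lambda>\<theta>. h (turn \<theta> * z))"
    and "(\<integral>\<theta>. h (turn \<theta> * z) \<partial>turn_measure) = integral {0..1} (\<lambda>\<theta>. h (turn \<theta> * z))"
proof -
  have cont: "continuous_on UNIV (\<lambda>\<theta>. h (turn \<theta> * z))"
    unfolding turn_def
    by (intro continuous_on_compose2[OF h] continuous_intros) (auto simp: norm_mult z)
  then have [measurable]: "(\<lambda>\<theta>. h (turn \<theta> * z)) \<in> borel_measurable borel"
    by (rule borel_measurable_continuous_onI)
  have turn: "turn_measure = density lborel (\<lambda>x. ennreal (indicator {0..1} x))"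
    by (simp add: turn_measure_def ennreal_indicator)
  have int: "set_integrable lborel {0..1} (\<lambda>\<theta>. h (turn \<theta> * z))"
    by (rule borel_integrable_atLeastAtMost') (rule continuous_on_subset[OF cont], simp)
  then show "integrable turn_measure (\<lambda>\<theta>. h (turn \<theta> * z))"
    unfolding turn by (subst integrable_density) (auto simp: set_integrable_def)
  have "(\<integral>\<theta>. h (turn \<theta> * z) \<partial>turn_measure) = (LINT \<theta>:{0..1}|lborel. h (turn \<theta> * z))"
    unfolding turn by (subst integral_density) (auto simp: set_lebesgue_integral_def)
  then show "(\<integral>\<theta>. h (turn \<theta> * z) \<partial>turn_measure) = integral {0..1} (\<lambda>\<theta>. h (turn \<theta> * z))"
    using set_borel_integral_eq_integral(2)[OF int] by simp
qed

text \<open>Cauchy's formula at 0 for \<open>\<lambda>w. h (w * z)\<close> on the unit circle; the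
  derivative of the path divided by the path is the constant \<open>2 * pi * \<i>\<close>, which
  leaves the plain mean over turns.\<close>

lemma holomorphic_turn_mean_value:
  assumes h: "h holomorphic_on ball 0 1" and z: "cmod z < 1"
  shows "(\<integral>\<theta>. h (turn \<theta> * z) \<partial>turn_measure) = h 0"
proof -
  have "(\<lambda>w. h (w * z)) holomorphic_on cball 0 1"
  proof (rule holomorphic_on_compose_gen[of "\<lambda>w. w * z" _ h, unfolded o_def, OF _ h])
    show "(\<lambda>w. w * z) ` cball 0 1 \<subseteq> ball 0 1"
      using z by (auto simp: norm_mult intro!: le_less_trans[OF mult_left_le_one_le])
  qed (intro holomorphic_intros)
  then have "((\<lambda>u. h (u * z) / (u - 0)) has_contour_integral (2 * of_real pi * \<i> * h (0 * z))) (circlepath 0 1)"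
    by (rule Cauchy_integral_circlepath_simple) simp
  then have I: "((\<lambda>x. h (circlepath 0 1 x * z) / (circlepath 0 1 x - 0) *
      vector_derivative (circlepath 0 1) (at x within {0..1})) has_integral (2 * of_real pi * \<i> * h (0 * z))) {0..1}"
    by (simp only: has_contour_integral_def)
  have "h (circlepath 0 1 x * z) / (circlepath 0 1 x - 0) * vector_derivative (circlepath 0 1) (at x within {0..1})
      = h (turn x * z) * (2 * of_real pi * \<i>)" if "x \<in> {0..1}" for x
    using that
    by (simp add: vector_derivative_circlepath01) (simp add: circlepath turn_def cis_conv_exp mult_ac)
  from iffD1[OF has_integral_cong[OF this] I]
  have "((\<lambda>x. h (turn x * z) * (2 * of_real pi * \<i>)) has_integral (2 * of_real pi * \<i> * h 0)) {0..1}"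
    by simp
  from has_integral_mult_left[OF this, of "inverse (2 * of_real pi * \<i>)"]
  have "((\<lambda>x. h (turn x * z)) has_integral h 0) {0..1}"
    by (simp add: field_simps)
  then show ?thesis
    using integrable_turn_measure(2)[OF holomorphic_on_imp_continuous_on[OF h] z]
    by (simp add: integral_unique)
qed

text \<open>At angle \<open>q * \<gamma>\<close> the cosine is already negative: beyond \<open>\<gamma>\<close> the term with \<open>B\<close> compensates
  \<open>|z| powr q\<close>, and below \<open>\<gamma>\<close> the real part is comparable to the modulus.\<close>

lemma right_half_plane_powr_bound:
  fixes q :: real
  assumes q: "1 < q" "q < 2"
  obtains A B :: real where "0 \<le> A" "0 \<le> B"
    "\<And>z. 0 < Re z \<Longrightarrow> cmod z powr q + B * Re (z powr of_real q) \<le> A * Re z powr q"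
proof -
  \<comment> \<open>\<open>q * \<gamma>\<close> is the midpoint of \<open>pi / 2\<close> and
    \<open>q * pi / 2\<close>. For \<open>1 < q < 2\<close> this puts \<open>\<gamma>\<close> below
    \<open>pi / 2\<close> and \<open>q * \<gamma>\<close> beyond \<open>pi / 2\<close>, yet within
    \<open>[0, pi]\<close>, where the cosine decreases.\<close>
  define \<gamma> where "\<gamma> = (pi / 2 + q * pi / 2) / (2 * q)"
  have q\<gamma>: "q * \<gamma> = (pi / 2 + q * pi / 2) / 2"
    using q by (simp add: \<gamma>_def)
  have \<gamma>_pos: "0 < \<gamma>" using q by (simp add: \<gamma>_def add_pos_pos)
  have \<gamma>_less: "\<gamma> < pi / 2"
  proof -
    have "q * \<gamma> < q * (pi / 2)" unfolding q\<gamma> using q by (simp add: field_simps)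
    then show ?thesis using q by simp
  qed
  have q\<gamma>_gt: "pi / 2 < q * \<gamma>" unfolding q\<gamma> using q by (simp add: field_simps)
  have q\<gamma>_le: "q * \<gamma> \<le> pi" unfolding q\<gamma> using q by (simp add: field_simps)
  \<comment> \<open>Both constants are fixed at the critical angle:
    \<open>B * cos (q * \<gamma>) = -1\<close> and
    \<open>A * cos \<gamma> powr q = 1 + B\<close>.\<close>
  define B where "B = 1 / (- cos (q * \<gamma>))"
  define A where "A = (1 + B) / cos \<gamma> powr q"
  have cosq: "cos (q * \<gamma>) < 0"
    using cos_monotone_0_pi[of "pi/2" "q * \<gamma>"] q\<gamma>_gt q\<gamma>_le by simp
  then have B: "0 \<le> B" by (simp add: B_def)
  have cos\<gamma>: "0 < cos \<gamma>" using \<gamma>_pos \<gamma>_less by (intro cos_gt_zero) auto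
  then have A: "0 \<le> A" using B by (simp add: A_def)
  have key: "1 + B * cos (q * \<alpha>) \<le> A * cos \<alpha> powr q" if "0 \<le> \<alpha>" "\<alpha> < pi / 2" for \<alpha>
  proof (cases "\<gamma> \<le> \<alpha>")
    case True
    have "q * \<alpha> \<le> pi"
    proof -
      have "q * \<alpha> \<le> 2 * (pi / 2)" using q that by (intro mult_mono) auto
      then show ?thesis by simp
    qed
    then have "cos (q * \<alpha>) \<le> cos (q * \<gamma>)"
      using True q \<gamma>_pos by (intro cos_monotone_0_pi_le) auto
    then have "B * cos (q * \<alpha>) \<le> B * cos (q * \<gamma>)" using B by (rule mult_left_mono)
    also have "\<dots> = - 1" using cosq by (simp add: B_def)
    finally have "1 + B * cos (q * \<alpha>) \<le> 0" by simp
    also have "0 \<le> A * cos \<alpha> powr q" using A by simp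
    finally show ?thesis .
  next
    case False
    have "cos \<gamma> powr q \<le> cos \<alpha> powr q"
      using False that \<gamma>_less cos\<gamma> q by (intro powr_mono2 cos_monotone_0_pi_le) auto
    then have "A * cos \<gamma> powr q \<le> A * cos \<alpha> powr q" using A by (rule mult_left_mono)
    moreover have "A * cos \<gamma> powr q = 1 + B" using cos\<gamma> by (simp add: A_def)
    moreover have "B * cos (q * \<alpha>) \<le> B * 1" using B by (intro mult_left_mono) auto
    ultimately show ?thesis by simp
  qed
  show thesis
  proof (rule that[OF A B])
    fix z :: complex assume z: "0 < Re z"
    then have z0: "z \<noteq> 0" by auto
    define \<alpha> where "\<alpha> = \<bar>Im (Ln z)\<bar>"
    have \<alpha>: "0 \<le> \<alpha>" "\<alpha> < pi / 2"
      using Re_Ln_pos_lt[OF z0] z by (auto simp: \<alpha>_def)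
    have "Re z = Re (exp (Ln z))" using z0 by simp
    also have "\<dots> = exp (Re (Ln z)) * cos (Im (Ln z))" by (rule Re_exp)
    also have "\<dots> = cmod z * cos \<alpha>"
      using z0 by (simp add: \<alpha>_def)
    finally have Re_z: "Re z = cmod z * cos \<alpha>" .
    have "Re (z powr of_real q) = exp (q * ln (cmod z)) * cos (q * Im (Ln z))"
      using z0 by (simp add: powr_def Re_exp)
    also have "cos (q * Im (Ln z)) = cos (q * \<alpha>)"
      unfolding \<alpha>_def by (metis abs_mult abs_of_pos cos_abs_real less_trans q(1) zero_less_one)
    finally have Re_powr: "Re (z powr of_real q) = cmod z powr q * cos (q * \<alpha>)"
      using z0 by (simp add: powr_def)
    have "cmod z powr q * (1 + B * cos (q * \<alpha>)) \<le> cmod z powr q * (A * cos \<alpha> powr q)"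
      using key[OF \<alpha>] by (intro mult_left_mono) auto
    then show "cmod z powr q + B * Re (z powr of_real q) \<le> A * Re z powr q"
      unfolding Re_z Re_powr using \<alpha> by (simp add: algebra_simps powr_mult)
  qed
qed

section \<open>The Poisson kernel and M. Riesz's inequality\<close>

definition poisson :: "complex \<Rightarrow> real" where
  "poisson \<zeta> = (1 - (cmod \<zeta>)\<^sup>2) / (cmod (1 - \<zeta>))\<^sup>2"

lemma poisson_eq_Re:
  assumes "\<zeta> \<noteq> 1"
  shows "poisson \<zeta> = Re (2 / (1 - \<zeta>) - 1)"
proof -
  have "2 / (1 - \<zeta>) - 1 = (1 + \<zeta>) / (1 - \<zeta>)"
    using assms by (simp add: field_simps)
  moreover have "Re ((1 + \<zeta>) / (1 - \<zeta>)) = ((1 + Re \<zeta>) * (1 - Re \<zeta>) - Im \<zeta> * Im \<zeta>) / (cmod (1 - \<zeta>))\<^sup>2"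
    by (simp add: Re_divide cmod_power2)
  ultimately show ?thesis
    by (simp add: poisson_def cmod_power2[of \<zeta>]) (simp add: power2_eq_square algebra_simps)
qed

text \<open>A Harnack bound, from \<open>|1 - \<zeta>| \<le> 1 + |\<zeta>|\<close>. Besides
  positivity of the kernel it lets a positive value of a Poisson integral at 0 spread to the whole
  disc; Riesz's argument needs a strictly positive real part.\<close>

lemma poisson_lower_bound:
  assumes "cmod \<zeta> < 1"
  shows "(1 - cmod \<zeta>) / 2 \<le> poisson \<zeta>"
proof -
  have "cmod (1 - \<zeta>) \<le> 1 + cmod \<zeta>" using norm_triangle_ineq4[of 1 \<zeta>] by simp
  then have le: "(cmod (1 - \<zeta>))\<^sup>2 \<le> (1 + cmod \<zeta>)\<^sup>2" by (intro power_mono) auto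
  have pos: "0 < (cmod (1 - \<zeta>))\<^sup>2" using assms by auto
  have "(1 - cmod \<zeta>) / 2 * (cmod (1 - \<zeta>))\<^sup>2 \<le> (1 - cmod \<zeta>) / 2 * (1 + cmod \<zeta>)\<^sup>2"
    using le assms by (intro mult_left_mono) auto
  also have "\<dots> = (1 - (cmod \<zeta>)\<^sup>2) * ((1 + cmod \<zeta>) / 2)"
    by (simp add: power2_eq_square field_simps)
  also have "\<dots> \<le> (1 - (cmod \<zeta>)\<^sup>2) * 1"
    using assms by (intro mult_left_mono) (auto simp: power_le_one)
  finally show ?thesis using pos by (simp add: poisson_def field_simps)
qed

lemma nn_integral_poisson_turn:
  assumes "cmod \<zeta> < 1"
  shows "(\<integral>\<^sup>+\<theta>. ennreal (poisson (turn \<theta> * \<zeta>)) \<partial>turn_measure) = 1"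
proof -
  let ?h = "\<lambda>\<zeta>::complex. 2 / (1 - \<zeta>) - 1"
  have hol: "?h holomorphic_on ball 0 1"
    by (intro holomorphic_intros) auto
  have less: "cmod (turn \<theta> * \<zeta>) < 1" for \<theta> using assms by (simp add: norm_mult)
  then have P: "poisson (turn \<theta> * \<zeta>) = Re (?h (turn \<theta> * \<zeta>))" for \<theta>
    by (metis less_irrefl norm_one poisson_eq_Re)
  have int: "integrable turn_measure (\<lambda>\<theta>. ?h (turn \<theta> * \<zeta>))"
    using integrable_turn_measure(1)[OF holomorphic_on_imp_continuous_on[OF hol] assms] .
  then have int_P: "integrable turn_measure (\<lambda>\<theta>. poisson (turn \<theta> * \<zeta>))"
    unfolding P by (rule integrable_Re)
  have "(\<integral>\<theta>. poisson (turn \<theta> * \<zeta>) \<partial>turn_measure) = Re (\<integral>\<theta>. ?h (turn \<theta> * \<zeta>) \<partial>turn_measure)"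
    unfolding P using int by (rule integral_Re)
  also have "\<dots> = 1" by (subst holomorphic_turn_mean_value[OF hol assms]) simp
  finally have "(\<integral>\<theta>. poisson (turn \<theta> * \<zeta>) \<partial>turn_measure) = 1" .
  moreover have "0 \<le> poisson (turn \<theta> * \<zeta>)" for \<theta>
    using poisson_lower_bound[OF less] less[of \<theta>] by (smt (verit) divide_nonneg_pos)
  ultimately show ?thesis
    by (subst nn_integral_eq_integral[OF int_P]) auto
qed

lemma nn_integral_turn_powr_le:
  fixes q :: real
  assumes q: "1 < q" "q < 2"
  obtains A :: real where "0 \<le> A"
    "\<And>H z. H holomorphic_on ball 0 1 \<Longrightarrow> (\<And>z. cmod z < 1 \<Longrightarrow> 0 < Re (H z)) \<Longrightarrow> Im (H 0) = 0 \<Longrightarrow>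
       cmod z < 1 \<Longrightarrow>
       (\<integral>\<^sup>+\<theta>. ennreal (cmod (H (turn \<theta> * z)) powr q) \<partial>turn_measure)
         \<le> ennreal A * (\<integral>\<^sup>+\<theta>. ennreal (Re (H (turn \<theta> * z)) powr q) \<partial>turn_measure)"
proof -
  obtain A B where A: "0 \<le> A" and B: "0 \<le> B"
    and bound: "\<And>z. 0 < Re z \<Longrightarrow> cmod z powr q + B * Re (z powr of_real q) \<le> A * Re z powr q"
    using right_half_plane_powr_bound[OF q] by blast
  show thesis
  proof (rule that[OF A])
    fix H :: "complex \<Rightarrow> complex" and z :: complex
    assume H: "H holomorphic_on ball 0 1" and pos: "\<And>z. cmod z < 1 \<Longrightarrow> 0 < Re (H z)"
      and H0: "Im (H 0) = 0" and z: "cmod z < 1"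
    have less: "cmod (turn \<theta> * z) < 1" for \<theta> using z by (simp add: norm_mult)
    have cH: "continuous_on (ball 0 1) H" using H by (rule holomorphic_on_imp_continuous_on)
    have nz: "H w \<noteq> 0" if "w \<in> ball 0 1" for w using pos[of w] that by auto
    have nonpos: "H w \<notin> \<real>\<^sub>\<le>\<^sub>0" if "w \<in> ball 0 1" for w
      using pos[of w] that by (auto simp: complex_nonpos_Reals_iff)
    have hol: "(\<lambda>w. H w powr of_real q) holomorphic_on ball 0 1"
      using nonpos by (intro holomorphic_on_powr H holomorphic_intros) auto
    have i1: "integrable turn_measure (\<lambda>\<theta>. cmod (H (turn \<theta> * z)) powr q)"
      using nz by (intro integrable_turn_measure(1)[of "\<lambda>w. cmod (H w) powr q"] z continuous_intros cH) auto
    have i2: "integrable turn_measure (\<lambda>\<theta>. Re (H (turn \<theta> * z)) powr q)"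
      using pos by (intro integrable_turn_measure(1)[of "\<lambda>w. Re (H w) powr q"] z continuous_intros cH) force+
    have i3: "integrable turn_measure (\<lambda>\<theta>. H (turn \<theta> * z) powr of_real q)"
      by (rule integrable_turn_measure(1)[of "\<lambda>w. H w powr of_real q", OF holomorphic_on_imp_continuous_on[OF hol] z])
    have "(\<integral>\<theta>. Re (H (turn \<theta> * z) powr of_real q) \<partial>turn_measure) = Re (H 0 powr of_real q)"
      using holomorphic_turn_mean_value[OF hol z] integral_Re[OF i3] by simp
    also have "H 0 = of_real (Re (H 0))" using H0 by (simp add: complex_eq_iff)
    then have "Re (H 0 powr of_real q) = Re (H 0) powr q"
      using pos[of 0] by (metis Re_complex_of_real less_eq_real_def norm_zero powr_of_real zero_less_one)
    finally have mean: "0 \<le> (\<integral>\<theta>. Re (H (turn \<theta> * z) powr of_real q) \<partial>turn_measure)"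
      by simp
    have "(\<integral>\<theta>. cmod (H (turn \<theta> * z)) powr q \<partial>turn_measure)
        \<le> (\<integral>\<theta>. cmod (H (turn \<theta> * z)) powr q \<partial>turn_measure)
          + B * (\<integral>\<theta>. Re (H (turn \<theta> * z) powr of_real q) \<partial>turn_measure)"
      using B mean by simp
    also have "\<dots> = (\<integral>\<theta>. cmod (H (turn \<theta> * z)) powr q + B * Re (H (turn \<theta> * z) powr of_real q) \<partial>turn_measure)"
      using i1 i3 by (simp add: integrable_Re)
    also have "\<dots> \<le> (\<integral>\<theta>. A * Re (H (turn \<theta> * z)) powr q \<partial>turn_measure)"
      using i1 i2 i3 pos less by (intro integral_mono bound) (auto simp: integrable_Re)
    also have "\<dots> = A * (\<integral>\<theta>. Re (H (turn \<theta> * z)) powr q \<partial>turn_measure)"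
      by simp
    finally show "(\<integral>\<^sup>+\<theta>. ennreal (cmod (H (turn \<theta> * z)) powr q) \<partial>turn_measure)
         \<le> ennreal A * (\<integral>\<^sup>+\<theta>. ennreal (Re (H (turn \<theta> * z)) powr q) \<partial>turn_measure)"
      using A by (simp add: nn_integral_eq_integral i1 i2 ennreal_mult[symmetric])
  qed
qed

section \<open>Poisson integrals of Lorentz functions\<close>

lemma measurable_poisson [measurable]: "poisson \<in> borel_measurable borel"
  unfolding poisson_def by measurable

lemma measurable_cnj [measurable]: "cnj \<in> borel_measurable borel"
  by (intro borel_measurable_continuous_onI continuous_intros)

lemma poisson_cnj: "poisson (cnj \<zeta>) = poisson \<zeta>"
  by (metis poisson_def complex_cnj_diff complex_cnj_one complex_mod_cnj)

lemma poisson_nonneg: "cmod \<zeta> < 1 \<Longrightarrow> 0 \<le> poisson \<zeta>"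
  using poisson_lower_bound[of \<zeta>] by (smt (verit) divide_nonneg_pos)

lemma norm_mult_cnj_less_1: "cmod z < 1 \<Longrightarrow> cmod w < 1 \<Longrightarrow> cmod (z * cnj w) < 1"
  using mult_strict_mono'[of "cmod z" 1 "cmod w" 1] by (simp add: norm_mult)

lemma norm_one_minus_mult_cnj:
  assumes "cmod z < 1" "cmod w < 1"
  shows "1 - cmod z \<le> cmod (1 - z * cnj w)"
proof -
  have "cmod (z * cnj w) \<le> cmod z"
    using assms by (simp add: norm_mult mult_left_le)
  then show ?thesis using norm_triangle_ineq2[of 1 "z * cnj w"] by simp
qed

lemma poisson_upper_bound:
  assumes "cmod z < 1" "cmod w < 1"
  shows "poisson (z * cnj w) \<le> 1 / (1 - cmod z)\<^sup>2"
proof -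
  have "(1 - cmod z)\<^sup>2 \<le> (cmod (1 - z * cnj w))\<^sup>2"
    using assms by (intro power_mono norm_one_minus_mult_cnj) auto
  then show ?thesis
    unfolding poisson_def using assms by (intro frac_le) auto
qed

text \<open>A weight depending on the height alone may be averaged over rotations of
  \<open>w\<close>, and every circle mean of the Poisson kernel is 1. The result is free of
  \<open>z\<close>, so the bounds built on it are uniform up to the boundary.\<close>

lemma nn_integral_height_poisson:
  fixes \<rho> :: "real \<Rightarrow> ennreal"
  assumes [measurable]: "\<rho> \<in> borel_measurable borel" and z: "cmod z < 1"
  shows "(\<integral>\<^sup>+w. \<rho> (disc_height w) * ennreal (poisson (z * cnj w)) \<partial>disc_measure)
       = (\<integral>\<^sup>+x\<in>{0<..<1}. \<rho> x \<partial>lborel)"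
proof -
  \<comment> \<open>Conjugation symmetry of the kernel lets the rotation act on
    \<open>w * cnj z\<close>.\<close>
  have rot: "poisson (z * cnj (turn \<theta> * w)) = poisson (turn \<theta> * (w * cnj z))" for \<theta> w
    using poisson_cnj[of "z * cnj (turn \<theta> * w)"] by (simp add: mult_ac)
  have "(\<integral>\<^sup>+w. \<rho> (disc_height w) * ennreal (poisson (z * cnj w)) \<partial>disc_measure)
      = (\<integral>\<^sup>+w. \<integral>\<^sup>+\<theta>. \<rho> (disc_height w) * ennreal (poisson (turn \<theta> * (w * cnj z))) \<partial>turn_measure \<partial>disc_measure)"
    by (subst nn_integral_disc_turn_average, measurable) (simp only: rot disc_height_turn)
  also have "\<dots> = (\<integral>\<^sup>+w. \<rho> (disc_height w) \<partial>disc_measure)"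
  proof (rule nn_integral_cong)
    fix w assume "w \<in> space disc_measure"
    then have "cmod (w * cnj z) < 1" using z norm_mult_cnj_less_1 by simp
    then show "(\<integral>\<^sup>+\<theta>. \<rho> (disc_height w) * ennreal (poisson (turn \<theta> * (w * cnj z))) \<partial>turn_measure)
        = \<rho> (disc_height w)"
      by (simp add: nn_integral_cmult nn_integral_poisson_turn)
  qed
  finally show ?thesis by (simp add: nn_integral_disc_height)
qed

section \<open>Poisson-type integrals over a single set\<close>

lemma nn_integral_powr_near_0:
  assumes "-1 < b" "0 \<le> m"
  shows "(\<integral>\<^sup>+x\<in>{0<..<1}. (if x < m then ennreal (x powr b) else 0) \<partial>lborel) \<le> ennreal (m powr (b + 1) / (b + 1))"
proof -
  have "(\<integral>\<^sup>+x\<in>{0<..<1}. (if x < m then ennreal (x powr b) else 0) \<partial>lborel)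
      \<le> (\<integral>\<^sup>+x. ennreal (x powr b) * indicator {0..m} x \<partial>lborel)"
    by (intro nn_integral_mono) (auto simp: indicator_def)
  also have "\<dots> = ennreal (m powr (b + 1) / (b + 1))"
    by (rule nn_integral_has_integral_lebesgue'[OF _ has_integral_powr_from_0[OF assms]]) simp
  finally show ?thesis .
qed

lemma nn_integral_powr_away_from_0:
  assumes "e < -1" "0 < m"
  shows "(\<integral>\<^sup>+x\<in>{0<..<1}. (if m \<le> x then ennreal (x powr e) else 0) \<partial>lborel) \<le> ennreal (m powr (e + 1) / (- e - 1))"
proof -
  have "(\<integral>\<^sup>+x\<in>{0<..<1}. (if m \<le> x then ennreal (x powr e) else 0) \<partial>lborel)
      \<le> (\<integral>\<^sup>+x. ennreal (x powr e) * indicator {m..} x \<partial>lborel)"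
    by (intro nn_integral_mono) (auto simp: indicator_def)
  also have "\<dots> = ennreal (- (m powr (e + 1)) / (e + 1))"
    by (rule nn_integral_has_integral_lebesgue'[OF _ has_integral_powr_to_inf[OF assms]]) simp
  also have "- (m powr (e + 1)) / (e + 1) = m powr (e + 1) / (- e - 1)"
    by (metis add_uminus_conv_diff minus_add_distrib minus_divide_divide minus_minus)
  finally show ?thesis .
qed

text \<open>For \<open>a > \<kappa>\<close>, split off \<open>a powr (1 - \<sigma>)\<close>, which
  is at most \<open>\<kappa> powr (1 - \<sigma>)\<close> because the exponent is not
  positive.\<close>

lemma le_add_powr_split:
  fixes a \<kappa> \<sigma> :: real
  assumes "0 \<le> a" "0 < \<kappa>" "1 \<le> \<sigma>"
  shows "a \<le> \<kappa> + \<kappa> powr (1 - \<sigma>) * a powr \<sigma>"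
proof (cases "a \<le> \<kappa>")
  case True
  then show ?thesis by (simp add: add_increasing2)
next
  case False
  then have "a = a powr (1 - \<sigma>) * a powr \<sigma>"
    using assms by (simp add: powr_add[symmetric])
  also have "\<dots> \<le> \<kappa> powr (1 - \<sigma>) * a powr \<sigma>"
    using False assms by (intro mult_right_mono powr_mono2') auto
  finally show ?thesis using assms by simp
qed

text \<open>The free parameter \<open>\<kappa>\<close> stands in for Hoelder's inequality; it is chosen
  in \<open>ennreal_powr_interpolation\<close>.\<close>

lemma nn_integral_set_height_poisson_le:
  fixes b \<sigma> \<kappa> :: real
  assumes b: "-1 < b" and \<sigma>: "1 \<le> \<sigma>" "b * \<sigma> < -1" and \<kappa>: "0 < \<kappa>"
    and E [measurable]: "E \<in> sets disc_measure" and z: "cmod z < 1"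
  defines "m \<equiv> measure disc_measure E"
  shows "(\<integral>\<^sup>+w\<in>E. ennreal (disc_height w powr b * poisson (z * cnj w)) \<partial>disc_measure)
    \<le> ennreal (m powr (b + 1) / (b + 1))
      + (ennreal (\<kappa> * m powr b) * (\<integral>\<^sup>+w\<in>E. ennreal (poisson (z * cnj w)) \<partial>disc_measure)
      + ennreal (\<kappa> powr (1 - \<sigma>) * (m powr (b + 1) / (- (b * \<sigma>) - 1))))"
\<comment> \<open>Null sets are treated apart because heights are divided by \<open>m\<close>
  below.\<close>
proof (cases "m = 0")
  case True
  then have "E \<in> null_sets disc_measure"
    by (simp add: m_def null_setsI disc_measure.emeasure_eq_measure)
  then show ?thesis by (subst nn_integral_null_set) auto
next
  case False
  then have m: "0 < m" by (simp add: m_def zero_less_measure_iff)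
  let ?P = "\<lambda>w. ennreal (poisson (z * cnj w))"
  let ?c = "\<kappa> powr (1 - \<sigma>) * m powr (b - b * \<sigma>)"
  let ?\<rho>1 = "\<lambda>x. if x < m then ennreal (x powr b) else 0"
  let ?\<rho>2 = "\<lambda>x. if m \<le> x then ennreal (x powr (b * \<sigma>)) else 0"
  \<comment> \<open>Below height \<open>m\<close> the set \<open>E\<close> is enlarged to the whole
    annulus; above it, \<open>E\<close> is kept only in the term with \<open>\<kappa>\<close>. The
    other two terms are then purely radial weights against the kernel.\<close>
  have pointwise: "ennreal (disc_height w powr b * poisson (z * cnj w)) * indicator E w
      \<le> ?\<rho>1 (disc_height w) * ?P w + (ennreal (\<kappa> * m powr b) * (?P w * indicator E w)
        + ennreal ?c * (?\<rho>2 (disc_height w) * ?P w))" if w: "w \<in> ball 0 1" for w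
  proof (cases "disc_height w < m")
    case True
    then have "ennreal (disc_height w powr b * poisson (z * cnj w)) * indicator E w
       \<le> ?\<rho>1 (disc_height w) * ?P w"
      by (auto simp: ennreal_mult' indicator_def)
    then show ?thesis by (rule order_trans) (simp add: add_increasing2)
  next
    case False
    let ?s = "disc_height w"
    have P: "0 \<le> poisson (z * cnj w)" using w z by (intro poisson_nonneg norm_mult_cnj_less_1) auto
    \<comment> \<open>Splitting the ratio \<open>?s / m\<close> keeps \<open>\<kappa>\<close> free
      of scale: the term with \<open>\<sigma>\<close> integrates to a multiple of
      \<open>m powr (b + 1)\<close>, as the part below height \<open>m\<close> does.\<close>
    have "(?s / m) powr b \<le> \<kappa> + \<kappa> powr (1 - \<sigma>) * ((?s / m) powr b) powr \<sigma>"
      using \<kappa> \<sigma> by (intro le_add_powr_split) auto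
    then have f1: "m powr b * (?s / m) powr b \<le> m powr b * (\<kappa> + \<kappa> powr (1 - \<sigma>) * ((?s / m) powr b) powr \<sigma>)"
      by (rule mult_left_mono) simp
    have f2: "m powr b * (?s / m) powr b = ?s powr b"
      using False m by (simp add: powr_mult[symmetric])
    have f3: "m powr b * ((?s / m) powr b) powr \<sigma> = m powr (b - b * \<sigma>) * ?s powr (b * \<sigma>)"
      using False m by (simp add: powr_powr powr_divide powr_diff)
    have f4: "m powr b * (\<kappa> + \<kappa> powr (1 - \<sigma>) * ((?s / m) powr b) powr \<sigma>)
        = \<kappa> * m powr b + \<kappa> powr (1 - \<sigma>) * (m powr b * ((?s / m) powr b) powr \<sigma>)"
      by (simp only: distrib_left mult.left_commute mult.commute)
    have "?s powr b \<le> \<kappa> * m powr b + ?c * ?s powr (b * \<sigma>)"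
      using f1 unfolding f2 f4 f3 by (simp only: mult.assoc)
    then have "?s powr b * poisson (z * cnj w)
        \<le> \<kappa> * m powr b * poisson (z * cnj w) + ?c * ?s powr (b * \<sigma>) * poisson (z * cnj w)"
      using P by (metis mult_right_mono distrib_right)
    then have "ennreal (?s powr b * poisson (z * cnj w))
        \<le> ennreal (\<kappa> * m powr b) * ?P w + ennreal ?c * (ennreal (?s powr (b * \<sigma>)) * ?P w)"
      using P \<kappa> by (simp add: ennreal_mult[symmetric] ennreal_plus[symmetric] mult.assoc del: ennreal_plus)
    then show ?thesis using False by (auto simp: indicator_def)
  qed
  have "(\<integral>\<^sup>+w\<in>E. ennreal (disc_height w powr b * poisson (z * cnj w)) \<partial>disc_measure)
     \<le> (\<integral>\<^sup>+w. ?\<rho>1 (disc_height w) * ?P w + (ennreal (\<kappa> * m powr b) * (?P w * indicator E w)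
        + ennreal ?c * (?\<rho>2 (disc_height w) * ?P w)) \<partial>disc_measure)"
    by (intro nn_integral_mono pointwise) simp
  also have "\<dots> = (\<integral>\<^sup>+w. ?\<rho>1 (disc_height w) * ?P w \<partial>disc_measure)
      + (ennreal (\<kappa> * m powr b) * (\<integral>\<^sup>+w\<in>E. ?P w \<partial>disc_measure)
        + ennreal ?c * (\<integral>\<^sup>+w. ?\<rho>2 (disc_height w) * ?P w \<partial>disc_measure))"
    by (subst nn_integral_add, measurable, subst nn_integral_add, measurable)
       (simp add: nn_integral_cmult)
  also have "\<dots> \<le> ennreal (m powr (b + 1) / (b + 1))
      + (ennreal (\<kappa> * m powr b) * (\<integral>\<^sup>+w\<in>E. ?P w \<partial>disc_measure)
        + ennreal ?c * ennreal (m powr (b * \<sigma> + 1) / (- (b * \<sigma>) - 1)))"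
    using nn_integral_powr_near_0[OF b] nn_integral_powr_away_from_0[OF \<sigma>(2) m] m
    by (subst (1 2) nn_integral_height_poisson[OF _ z]) (auto intro!: add_mono mult_left_mono)
  also have "ennreal ?c * ennreal (m powr (b * \<sigma> + 1) / (- (b * \<sigma>) - 1))
      = ennreal (\<kappa> powr (1 - \<sigma>) * (m powr (b + 1) / (- (b * \<sigma>) - 1)))"
    using \<sigma> m by (simp add: ennreal_mult[symmetric] powr_add[symmetric])
  finally show ?thesis .
qed

section \<open>Level sets, layer cake and circle means\<close>

definition level_size :: "(complex \<Rightarrow> real) \<Rightarrow> real \<Rightarrow> real" where
  "level_size f t = measure disc_measure {w. cmod w < 1 \<and> t < f w}"

text \<open>For nonnegative \<open>f\<close> and \<open>p = 1 / (b + 1)\<close> this is the Lorentz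
  functional without its factor \<open>p\<close>.\<close>

definition level_norm :: "real \<Rightarrow> (complex \<Rightarrow> real) \<Rightarrow> ennreal" where
  "level_norm b f = (\<integral>\<^sup>+t\<in>{0<..}. ennreal (level_size f t powr (b + 1)) \<partial>lborel)"

text \<open>The weight is chosen for the circle means: a level set of measure \<open>m\<close> has
  Poisson mean \<open>m\<close>, and \<open>m powr b * m = m powr (b + 1)\<close> is its share of
  \<open>level_norm\<close>.\<close>

definition level_poisson :: "real \<Rightarrow> (complex \<Rightarrow> real) \<Rightarrow> complex \<Rightarrow> ennreal" where
  "level_poisson b f z = (\<integral>\<^sup>+t\<in>{0<..}. ennreal (level_size f t powr b)
      * (\<integral>\<^sup>+w. (if t < f w then ennreal (poisson (z * cnj w)) else 0) \<partial>disc_measure) \<partial>lborel)"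

definition height_poisson :: "real \<Rightarrow> (complex \<Rightarrow> real) \<Rightarrow> complex \<Rightarrow> ennreal" where
  "height_poisson b f z = (\<integral>\<^sup>+w. ennreal (f w) * ennreal (disc_height w powr b * poisson (z * cnj w)) \<partial>disc_measure)"

lemma sets_level [measurable]:
  assumes [measurable]: "f \<in> borel_measurable disc_measure"
  shows "{w. cmod w < 1 \<and> (t::real) < f w} \<in> sets disc_measure"
proof -
  have "{w \<in> space disc_measure. t < f w} \<in> sets disc_measure" by measurable
  then show ?thesis by simp
qed

lemma measurable_level_size [measurable]:
  assumes [measurable]: "f \<in> borel_measurable disc_measure"
  shows "level_size f \<in> borel_measurable borel"
proof -
  have "mono (\<lambda>t. - level_size f t)"
    unfolding level_size_def
    by (intro monoI) (auto intro!: disc_measure.finite_measure_mono sets_level)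
  then have "(\<lambda>t. - (- level_size f t)) \<in> borel_measurable borel"
    by (intro borel_measurable_uminus borel_measurable_mono)
  then show ?thesis by simp
qed

interpretation lborel_disc: pair_sigma_finite "lborel :: real measure" disc_measure ..
interpretation lborel_turn: pair_sigma_finite "lborel :: real measure" turn_measure ..

text \<open>\<open>ennreal (f w)\<close> is the length of \<open>{0<..<f w}\<close>, also for
  negative \<open>f w\<close>, where both vanish; Tonelli does the rest.\<close>

lemma nn_integral_layer_cake:
  fixes k :: "complex \<Rightarrow> ennreal"
  assumes [measurable]: "f \<in> borel_measurable disc_measure" "k \<in> borel_measurable disc_measure"
  shows "(\<integral>\<^sup>+w. ennreal (f w) * k w \<partial>disc_measure)
       = (\<integral>\<^sup>+t\<in>{0<..}. (\<integral>\<^sup>+w. (if t < f w then k w else 0) \<partial>disc_measure) \<partial>lborel)"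
proof -
  have "ennreal (f w) * k w = (\<integral>\<^sup>+t. (if 0 < t \<and> t < f w then k w else 0) \<partial>lborel)" for w
  proof -
    have "(\<integral>\<^sup>+t. (if 0 < t \<and> t < f w then k w else 0) \<partial>lborel)
        = (\<integral>\<^sup>+t. k w * indicator {0<..<f w} t \<partial>lborel)"
      by (intro nn_integral_cong) auto
    also have "\<dots> = k w * emeasure lborel {0<..<f w}"
      by (rule nn_integral_cmult_indicator) simp
    also have "emeasure lborel {0<..<f w} = ennreal (f w)"
      by (cases "0 \<le> f w") (auto simp: ennreal_neg)
    finally show ?thesis by (simp add: mult.commute)
  qed
  then have "(\<integral>\<^sup>+w. ennreal (f w) * k w \<partial>disc_measure)
      = (\<integral>\<^sup>+w. \<integral>\<^sup>+t. (if 0 < t \<and> t < f w then k w else 0) \<partial>lborel \<partial>disc_measure)"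
    by simp
  also have "\<dots> = (\<integral>\<^sup>+t. \<integral>\<^sup>+w. (if 0 < t \<and> t < f w then k w else 0) \<partial>disc_measure \<partial>lborel)"
    by (rule lborel_disc.Fubini') simp
  also have "\<dots> = (\<integral>\<^sup>+t\<in>{0<..}. (\<integral>\<^sup>+w. (if t < f w then k w else 0) \<partial>disc_measure) \<partial>lborel)"
    by (intro nn_integral_cong) (auto simp: indicator_def)
  finally show ?thesis .
qed

lemma nn_integral_level_eq:
  "(\<integral>\<^sup>+w. (if t < f w then k w else 0) \<partial>disc_measure)
   = (\<integral>\<^sup>+w\<in>{w. cmod w < 1 \<and> t < f w}. k w \<partial>disc_measure)"
  by (intro nn_integral_cong) (auto simp: indicator_def)

text \<open>One \<open>\<kappa>\<close> serves all levels at once but may still depend on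
  \<open>z\<close>; \<open>ennreal_powr_interpolation\<close> uses this freedom pointwise.\<close>

lemma height_poisson_le:
  fixes b \<sigma> \<kappa> :: real
  assumes b: "-1 < b" and \<sigma>: "1 \<le> \<sigma>" "b * \<sigma> < -1" and \<kappa>: "0 < \<kappa>"
    and [measurable]: "f \<in> borel_measurable disc_measure" and z: "cmod z < 1"
  shows "height_poisson b f z \<le> ennreal (1 / (b + 1)) * level_norm b f
     + (ennreal \<kappa> * level_poisson b f z + ennreal (\<kappa> powr (1 - \<sigma>) / (- (b * \<sigma>) - 1)) * level_norm b f)"
proof -
  let ?m = "level_size f"
  let ?P = "\<lambda>t. (\<integral>\<^sup>+w. (if t < f w then ennreal (poisson (z * cnj w)) else 0) \<partial>disc_measure)"
  have [measurable]: "?P \<in> borel_measurable borel" by measurable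
  have "height_poisson b f z
      = (\<integral>\<^sup>+t\<in>{0<..}. (\<integral>\<^sup>+w. (if t < f w then ennreal (disc_height w powr b * poisson (z * cnj w)) else 0) \<partial>disc_measure) \<partial>lborel)"
    unfolding height_poisson_def by (rule nn_integral_layer_cake) simp_all
  also have "\<dots> \<le> (\<integral>\<^sup>+t\<in>{0<..}. (ennreal (?m t powr (b + 1) / (b + 1))
      + (ennreal (\<kappa> * ?m t powr b) * ?P t
      + ennreal (\<kappa> powr (1 - \<sigma>) * (?m t powr (b + 1) / (- (b * \<sigma>) - 1))))) \<partial>lborel)"
    unfolding nn_integral_level_eq level_size_def
    by (intro nn_integral_mono mult_right_mono nn_integral_set_height_poisson_le b \<sigma> \<kappa> z) simp_all
  also have "\<dots> = (\<integral>\<^sup>+t. (ennreal (1 / (b + 1)) * (ennreal (?m t powr (b + 1)) * indicator {0<..} t)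
      + (ennreal \<kappa> * (ennreal (?m t powr b) * ?P t * indicator {0<..} t)
      + ennreal (\<kappa> powr (1 - \<sigma>) / (- (b * \<sigma>) - 1)) * (ennreal (?m t powr (b + 1)) * indicator {0<..} t))) \<partial>lborel)"
    using b \<sigma> \<kappa> by (intro nn_integral_cong) (auto simp: indicator_def ennreal_mult[symmetric] mult.assoc[symmetric])
  also have "\<dots> = ennreal (1 / (b + 1)) * level_norm b f
     + (ennreal \<kappa> * level_poisson b f z + ennreal (\<kappa> powr (1 - \<sigma>) / (- (b * \<sigma>) - 1)) * level_norm b f)"
    unfolding level_norm_def level_poisson_def
    by (subst nn_integral_add, measurable, subst nn_integral_add, measurable)
       (simp add: nn_integral_cmult)
  finally show ?thesis .
qed

text \<open>Includes \<open>x = 0\<close>, since \<open>0 powr b\<close> is 0; null level sets thus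
  need no separate treatment.\<close>

lemma powr_mult_self:
  fixes x :: real
  assumes "0 \<le> x"
  shows "x powr b * x = x powr (b + 1)"
  using assms by (cases "x = 0") (auto simp: powr_add)

text \<open>The bound blows up at the boundary and serves only for finiteness and vanishing at
  single points; the uniform information is in the circle means.\<close>

lemma level_poisson_le:
  assumes [measurable]: "f \<in> borel_measurable disc_measure" and z: "cmod z < 1"
  shows "level_poisson b f z \<le> ennreal (1 / (1 - cmod z)\<^sup>2) * level_norm b f"
proof -
  let ?c = "1 / (1 - cmod z)\<^sup>2"
  have "(\<integral>\<^sup>+w. (if t < f w then ennreal (poisson (z * cnj w)) else 0) \<partial>disc_measure) \<le> ennreal ?c * ennreal (level_size f t)" for t
  proof -
    have "(\<integral>\<^sup>+w. (if t < f w then ennreal (poisson (z * cnj w)) else 0) \<partial>disc_measure)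
       \<le> (\<integral>\<^sup>+w. ennreal ?c * indicator {w. cmod w < 1 \<and> t < f w} w \<partial>disc_measure)"
      using poisson_upper_bound[OF z] by (intro nn_integral_mono) (auto simp: ennreal_leI)
    also have "\<dots> = ennreal ?c * emeasure disc_measure {w. cmod w < 1 \<and> t < f w}"
      by (rule nn_integral_cmult_indicator) simp
    finally show ?thesis
      by (simp add: level_size_def disc_measure.emeasure_eq_measure)
  qed
  then have "level_poisson b f z \<le> (\<integral>\<^sup>+t\<in>{0<..}. ennreal (level_size f t powr b) * (ennreal ?c * ennreal (level_size f t)) \<partial>lborel)"
    unfolding level_poisson_def by (intro nn_integral_mono mult_right_mono mult_left_mono) auto
  also have "\<dots> = (\<integral>\<^sup>+t. ennreal ?c * (ennreal (level_size f t powr (b + 1)) * indicator {0<..} t) \<partial>lborel)"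
    by (intro nn_integral_cong)
       (auto simp: indicator_def ennreal_mult[symmetric] powr_mult_self[symmetric] level_size_def mult_ac)
  also have "\<dots> = ennreal ?c * level_norm b f"
    unfolding level_norm_def by (rule nn_integral_cmult) simp
  finally show ?thesis .
qed

text \<open>Every \<open>w\<close> contributes a circle mean of the Poisson kernel, which is 1. The
  value is the same on all circles: this is the linear information from which the means of
  \<open>q\<close>-th powers are estimated.\<close>

lemma nn_integral_level_poisson_turn:
  assumes [measurable]: "f \<in> borel_measurable disc_measure" and z: "cmod z < 1"
  shows "(\<integral>\<^sup>+\<theta>. level_poisson b f (turn \<theta> * z) \<partial>turn_measure) = level_norm b f"
proof -
  have inner: "(\<integral>\<^sup>+\<theta>. (\<integral>\<^sup>+w. (if t < f w then ennreal (poisson (turn \<theta> * z * cnj w)) else 0) \<partial>disc_measure) \<partial>turn_measure)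
      = ennreal (level_size f t)" for t
  proof -
    have "(\<integral>\<^sup>+\<theta>. (\<integral>\<^sup>+w. (if t < f w then ennreal (poisson (turn \<theta> * z * cnj w)) else 0) \<partial>disc_measure) \<partial>turn_measure)
       = (\<integral>\<^sup>+w. (\<integral>\<^sup>+\<theta>. (if t < f w then ennreal (poisson (turn \<theta> * z * cnj w)) else 0) \<partial>turn_measure) \<partial>disc_measure)"
      by (rule turn_disc.Fubini'[symmetric]) simp
    also have "\<dots> = (\<integral>\<^sup>+w. indicator {w. cmod w < 1 \<and> t < f w} w \<partial>disc_measure)"
    proof (rule nn_integral_cong)
      fix w assume "w \<in> space disc_measure"
      then show "(\<integral>\<^sup>+\<theta>. (if t < f w then ennreal (poisson (turn \<theta> * z * cnj w)) else 0) \<partial>turn_measure)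
          = indicator {w. cmod w < 1 \<and> t < f w} w"
        using nn_integral_poisson_turn[OF norm_mult_cnj_less_1[OF z, of w]]
        by (cases "t < f w") (simp_all add: mult.assoc)
    qed
    also have "\<dots> = emeasure disc_measure {w. cmod w < 1 \<and> t < f w}"
      by (rule nn_integral_indicator) simp
    finally show ?thesis by (simp add: level_size_def disc_measure.emeasure_eq_measure)
  qed
  have "(\<integral>\<^sup>+\<theta>. level_poisson b f (turn \<theta> * z) \<partial>turn_measure)
     = (\<integral>\<^sup>+t. (\<integral>\<^sup>+\<theta>. ennreal (level_size f t powr b)
      * (\<integral>\<^sup>+w. (if t < f w then ennreal (poisson (turn \<theta> * z * cnj w)) else 0) \<partial>disc_measure) * indicator {0<..} t \<partial>turn_measure) \<partial>lborel)"
    unfolding level_poisson_def by (rule lborel_turn.Fubini') measurable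
  also have "\<dots> = (\<integral>\<^sup>+t. ennreal (level_size f t powr b) * ennreal (level_size f t) * indicator {0<..} t \<partial>lborel)"
    by (intro nn_integral_cong) (simp add: nn_integral_cmult nn_integral_multc inner)
  also have "\<dots> = level_norm b f"
    unfolding level_norm_def
    by (intro nn_integral_cong) (auto simp: ennreal_mult[symmetric] powr_mult_self level_size_def indicator_def)
  finally show ?thesis .
qed

text \<open>Optimizing \<open>\<kappa>\<close> bounds \<open>V\<close> by a constant times
  \<open>n * (1 + x / n) powr (1 / q)\<close>. Its \<open>q\<close>-th power is affine in
  \<open>x\<close>, so control of the circle means of \<open>x\<close> is enough.\<close>

lemma ennreal_powr_interpolation:
  fixes n x q \<sigma> c1 c2 :: real and V :: ennreal
  assumes q: "1 < q" and \<sigma>: "\<sigma> = q / (q - 1)" and n: "0 < n" and x: "0 \<le> x"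
    and c: "0 \<le> c1" "0 \<le> c2"
    and V: "\<And>\<kappa>. 0 < \<kappa> \<Longrightarrow> V \<le> ennreal (c1 * n + (\<kappa> * x + \<kappa> powr (1 - \<sigma>) * c2 * n))"
  shows "enn2real V powr q \<le> (c1 + 1 + c2) powr q * (n powr q * (1 + x / n))"
proof -
  \<comment> \<open>The shift by 1 keeps \<open>y\<close> away from 0 when \<open>x = 0\<close>, and
    \<open>y \<ge> 1\<close> lets the term \<open>c1 * n\<close> be absorbed.\<close>
  define y where "y = 1 + x / n"
  have y: "1 \<le> y" using n x by (simp add: y_def)
  \<comment> \<open>The balancing value: \<open>\<kappa> * x\<close> and
    \<open>\<kappa> powr (1 - \<sigma>) * n\<close> are both at most
    \<open>n * y powr (1 / q)\<close>, since
    \<open>(1 / q - 1) * (1 - \<sigma>) = 1 / q\<close>.\<close>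
  define \<kappa> where "\<kappa> = y powr (1 / q - 1)"
  have \<kappa>: "0 < \<kappa>" using y by (simp add: \<kappa>_def)
  have y1: "1 \<le> y powr (1 / q)" using y q by (intro ge_one_powr_ge_zero) auto
  have "\<kappa> * x \<le> \<kappa> * (y * n)"
    using n x \<kappa> by (intro mult_left_mono) (auto simp: y_def field_simps)
  also have "\<dots> = y powr (1 / q) * n"
    using y powr_mult_self[of y "1 / q - 1"] by (simp add: \<kappa>_def mult.assoc[symmetric])
  finally have 1: "\<kappa> * x \<le> y powr (1 / q) * n" .
  have "(1 / q - 1) * (1 - \<sigma>) = 1 / q"
    using q by (simp add: \<sigma> field_simps)
  then have 2: "\<kappa> powr (1 - \<sigma>) = y powr (1 / q)"
    by (simp add: \<kappa>_def powr_powr)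
  have "c1 * n * 1 \<le> c1 * n * y powr (1 / q)"
    using c n y1 by (intro mult_left_mono) auto
  with 1 have "c1 * n + (\<kappa> * x + \<kappa> powr (1 - \<sigma>) * c2 * n) \<le> (c1 + 1 + c2) * (n * y powr (1 / q))"
    unfolding 2 by (simp add: algebra_simps)
  then have "V \<le> ennreal ((c1 + 1 + c2) * (n * y powr (1 / q)))"
    by (rule order_trans[OF V[OF \<kappa>] ennreal_leI])
  then have "enn2real V \<le> (c1 + 1 + c2) * (n * y powr (1 / q))"
    using c n by (intro enn2real_leI) auto
  then have "enn2real V powr q \<le> ((c1 + 1 + c2) * (n * y powr (1 / q))) powr q"
    using q by (intro powr_mono2) auto
  also have "\<dots> = (c1 + 1 + c2) powr q * (n powr q * y)"
    using q c n y by (simp add: powr_mult powr_powr)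
  finally show ?thesis by (simp add: y_def)
qed

lemma level_poisson_finite:
  assumes "f \<in> borel_measurable disc_measure" "level_norm b f < \<infinity>" "cmod z < 1"
  shows "level_poisson b f z < \<infinity>"
  using level_poisson_le[OF assms(1,3), of b] assms(2)
  by (auto simp: ennreal_mult_less_top intro: le_less_trans)

lemma height_poisson_finite:
  assumes b: "-1 < b" "b < 0" and f: "f \<in> borel_measurable disc_measure" "level_norm b f < \<infinity>" and z: "cmod z < 1"
  shows "height_poisson b f z < \<infinity>"
proof -
  \<comment> \<open>Any admissible parameters do for finiteness: here \<open>\<kappa> = 1\<close>,
    and \<open>\<sigma> = 1 - 2 / b\<close> exceeds 1 and satisfies
    \<open>b * \<sigma> = b - 2 < -1\<close>.\<close>
  have "height_poisson b f z \<le> ennreal (1 / (b + 1)) * level_norm b f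
     + (ennreal 1 * level_poisson b f z + ennreal (1 powr (1 - (1 - 2 / b)) / (- (b * (1 - 2 / b)) - 1)) * level_norm b f)"
    using b by (intro height_poisson_le f z) (auto simp: algebra_simps divide_le_0_iff)
  also have "\<dots> < \<infinity>"
    using f level_poisson_finite[OF f z] by (auto simp: ennreal_mult_less_top)
  finally show ?thesis .
qed

lemma measurable_height_poisson [measurable]:
  assumes [measurable]: "f \<in> borel_measurable disc_measure"
  shows "height_poisson b f \<in> borel_measurable borel"
  unfolding height_poisson_def by measurable

lemma nn_integral_height_poisson_powr_turn_le:
  fixes b q :: real
  assumes b: "-1 < b" "b < 0" and q: "1 < q" "q * (b + 1) < 1"
  obtains C :: real where "0 < C"
    "\<And>f z. f \<in> borel_measurable disc_measure \<Longrightarrow> level_norm b f < \<infinity> \<Longrightarrow> 0 < level_norm b f \<Longrightarrow> cmod z < 1 \<Longrightarrow>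
      (\<integral>\<^sup>+\<theta>. ennreal (enn2real (height_poisson b f (turn \<theta> * z)) powr q) \<partial>turn_measure)
        \<le> ennreal (C * enn2real (level_norm b f) powr q)"
proof -
  \<comment> \<open>The exponent conjugate to \<open>q\<close>; \<open>b * \<sigma> < -1\<close> is
    a rewriting of \<open>q * (b + 1) < 1\<close>.\<close>
  define \<sigma> where "\<sigma> = q / (q - 1)"
  have \<sigma>: "1 \<le> \<sigma>" using q by (simp add: \<sigma>_def)
  have b\<sigma>: "b * \<sigma> < -1"
  proof -
    have "b * q < - (q - 1)" using q by (simp add: algebra_simps)
    then show ?thesis using q by (simp add: \<sigma>_def field_simps)
  qed
  define c1 where "c1 = 1 / (b + 1)"
  define c2 where "c2 = 1 / (- (b * \<sigma>) - 1)"
  have c: "0 \<le> c1" "0 \<le> c2" using b b\<sigma> by (auto simp: c1_def c2_def)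
  \<comment> \<open>The 2 is the circle mean of \<open>1 + level_poisson / n\<close>, both summands
    having mean 1.\<close>
  define C where "C = 2 * (c1 + 1 + c2) powr q"
  show thesis
  proof (rule that)
    show "0 < C" using c by (simp add: C_def)
  next
    fix f z
    assume f [measurable]: "f \<in> borel_measurable disc_measure" and fin: "level_norm b f < \<infinity>"
      and pos: "0 < level_norm b f" and z: "cmod z < 1"
    define n where "n = enn2real (level_norm b f)"
    have n_eq: "level_norm b f = ennreal n" using fin by (simp add: n_def)
    then have n: "0 < n" using pos by simp
    have bound: "enn2real (height_poisson b f w) powr q
      \<le> (c1 + 1 + c2) powr q * (n powr q * (1 + enn2real (level_poisson b f w) / n))" if w: "cmod w < 1" for w
    proof (rule ennreal_powr_interpolation[OF q(1) \<sigma>_def n _ c])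
      fix \<kappa> :: real assume \<kappa>: "0 < \<kappa>"
      define x where "x = enn2real (level_poisson b f w)"
      have x: "level_poisson b f w = ennreal x" "0 \<le> x"
        using level_poisson_finite[OF f fin w] by (simp_all add: x_def)
      have "height_poisson b f w \<le> ennreal c1 * level_norm b f
        + (ennreal \<kappa> * level_poisson b f w + ennreal (\<kappa> powr (1 - \<sigma>) / (- (b * \<sigma>) - 1)) * level_norm b f)"
        unfolding c1_def by (rule height_poisson_le[OF b(1) \<sigma> b\<sigma> \<kappa> f w])
      also have "\<kappa> powr (1 - \<sigma>) / (- (b * \<sigma>) - 1) = \<kappa> powr (1 - \<sigma>) * c2"
        by (simp add: c2_def)
      finally show "height_poisson b f w
          \<le> ennreal (c1 * n + (\<kappa> * enn2real (level_poisson b f w) + \<kappa> powr (1 - \<sigma>) * c2 * n))"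
        using \<kappa> n x c unfolding n_eq x_def[symmetric]
        by (simp add: ennreal_mult[symmetric] ennreal_plus[symmetric] del: ennreal_plus)
    qed simp
    have less: "cmod (turn \<theta> * z) < 1" for \<theta> using z by (simp add: norm_mult)
    have "(\<integral>\<^sup>+\<theta>. ennreal (enn2real (height_poisson b f (turn \<theta> * z)) powr q) \<partial>turn_measure)
       \<le> (\<integral>\<^sup>+\<theta>. ennreal ((c1 + 1 + c2) powr q * n powr q)
          * (1 + ennreal (1 / n) * level_poisson b f (turn \<theta> * z)) \<partial>turn_measure)"
    proof (rule nn_integral_mono)
      fix \<theta>
      define x where "x = enn2real (level_poisson b f (turn \<theta> * z))"
      have x: "level_poisson b f (turn \<theta> * z) = ennreal x" "0 \<le> x"
        using level_poisson_finite[OF f fin less] by (simp_all add: x_def)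
      show "ennreal (enn2real (height_poisson b f (turn \<theta> * z)) powr q)
         \<le> ennreal ((c1 + 1 + c2) powr q * n powr q) * (1 + ennreal (1 / n) * level_poisson b f (turn \<theta> * z))"
        using ennreal_leI[OF bound[OF less[of \<theta>]]] n x c unfolding x(1)
        by (simp add: ennreal_mult[symmetric] ennreal_plus[symmetric] ennreal_1[symmetric] mult.assoc
              del: ennreal_plus ennreal_1)
    qed
    also have "\<dots> = ennreal ((c1 + 1 + c2) powr q * n powr q) * (1 + ennreal (1 / n) * ennreal n)"
    proof -
      have [measurable]: "level_poisson b f \<in> borel_measurable borel"
        unfolding level_poisson_def by measurable
      show ?thesis
        by (simp add: nn_integral_cmult nn_integral_add nn_integral_level_poisson_turn[OF f z] n_eq)
    qed
    also have "\<dots> = ennreal (C * n powr q)"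
    proof -
      have "1 + ennreal (1 / n) * ennreal n = ennreal 2"
        using n by (simp add: ennreal_mult[symmetric])
      then show ?thesis by (metis C_def ennreal_mult'' mult.assoc mult.commute zero_le_numeral)
    qed
    finally show "(\<integral>\<^sup>+\<theta>. ennreal (enn2real (height_poisson b f (turn \<theta> * z)) powr q) \<partial>turn_measure)
        \<le> ennreal (C * enn2real (level_norm b f) powr q)"
      by (simp add: n_def)
  qed
qed

section \<open>Cauchy transforms\<close>

definition cauchy_transform :: "(complex \<Rightarrow> complex) \<Rightarrow> complex \<Rightarrow> complex" where
  "cauchy_transform g z = (\<integral>w. g w / (1 - z * cnj w) \<partial>disc_measure)"

lemma integrable_cauchy_kernel:
  assumes g: "integrable disc_measure g" and z: "cmod z < 1"
  shows "integrable disc_measure (\<lambda>w. g w / (1 - z * cnj w))"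
proof (rule Bochner_Integration.integrable_bound)
  show "integrable disc_measure (\<lambda>w. g w / of_real (1 - cmod z))"
    using g by simp
  have [measurable]: "g \<in> borel_measurable disc_measure" using g by auto
  show "(\<lambda>w. g w / (1 - z * cnj w)) \<in> borel_measurable disc_measure" by measurable
  show "AE w in disc_measure. norm (g w / (1 - z * cnj w)) \<le> norm (g w / of_real (1 - cmod z))"
  proof (rule AE_I2)
    fix w assume "w \<in> space disc_measure"
    then show "norm (g w / (1 - z * cnj w)) \<le> norm (g w / of_real (1 - cmod z))"
      using norm_one_minus_mult_cnj[OF z, of w] z unfolding norm_divide norm_of_real
      by (intro divide_left_mono) (auto intro!: mult_pos_pos)
  qed
qed

text \<open>The kernel is expanded geometrically. With the majorant \<open>|g w| * |z| ^ n\<close>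
  the series is integrated term by term, and the moments of \<open>g\<close> against
  \<open>cnj w ^ n\<close> become the coefficients.\<close>

lemma holomorphic_cauchy_transform:
  assumes g: "integrable disc_measure g"
  shows "cauchy_transform g holomorphic_on ball 0 1"
proof (rule power_series_holomorphic)
  fix z :: complex assume "z \<in> ball 0 1"
  then have z: "cmod z < 1" by simp
  have [measurable]: "g \<in> borel_measurable disc_measure" using g by auto
  have le: "cmod (g w * (z * cnj w) ^ n) \<le> cmod (g w) * cmod z ^ n" if "cmod w < 1" for w n
    using that unfolding norm_mult norm_power complex_mod_cnj
    by (intro mult_left_mono power_mono mult_left_le) auto
  have int0: "integrable disc_measure (\<lambda>w. g w * cnj w ^ n)" for n
  proof (rule Bochner_Integration.integrable_bound[OF g])
    show "AE w in disc_measure. norm (g w * cnj w ^ n) \<le> norm (g w)"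
      by (rule AE_I2) (auto simp: norm_mult norm_power intro!: mult_left_le power_le_one)
  qed simp
  have int: "integrable disc_measure (\<lambda>w. g w * (z * cnj w) ^ n)" for n
    using integrable_mult_right[OF int0, of "z ^ n" n] by (simp add: power_mult_distrib mult_ac)
  have coeff: "(\<integral>w. g w * (z * cnj w) ^ n \<partial>disc_measure) = (\<integral>w. g w * cnj w ^ n \<partial>disc_measure) * (z - 0) ^ n" for n
  proof -
    have "(\<integral>w. g w * (z * cnj w) ^ n \<partial>disc_measure) = (\<integral>w. g w * cnj w ^ n * z ^ n \<partial>disc_measure)"
      by (intro Bochner_Integration.integral_cong) (simp_all add: power_mult_distrib mult_ac)
    then show ?thesis by simp
  qed
  have "(\<lambda>n. \<integral>w. g w * (z * cnj w) ^ n \<partial>disc_measure) sums (\<integral>w. (\<Sum>n. g w * (z * cnj w) ^ n) \<partial>disc_measure)"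
  proof (rule sums_integral)
    show "AE w in disc_measure. summable (\<lambda>n. norm (g w * (z * cnj w) ^ n))"
    proof (rule AE_I2)
      fix w assume "w \<in> space disc_measure"
      then have "norm (cmod (z * cnj w)) < 1" using norm_mult_cnj_less_1[OF z] by simp
      then show "summable (\<lambda>n. norm (g w * (z * cnj w) ^ n))"
        unfolding norm_mult[of "g w"] norm_power by (intro summable_mult summable_geometric)
    qed
    show "summable (\<lambda>n. \<integral>w. norm (g w * (z * cnj w) ^ n) \<partial>disc_measure)"
    proof (rule summable_comparison_test')
      show "summable (\<lambda>n. (\<integral>w. cmod (g w) \<partial>disc_measure) * cmod z ^ n)"
        using z by (intro summable_mult summable_geometric) simp
      fix n
      have "(\<integral>w. norm (g w * (z * cnj w) ^ n) \<partial>disc_measure) \<le> (\<integral>w. cmod (g w) * cmod z ^ n \<partial>disc_measure)"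
        using g int le by (intro integral_mono) auto
      then show "norm (\<integral>w. norm (g w * (z * cnj w) ^ n) \<partial>disc_measure) \<le> (\<integral>w. cmod (g w) \<partial>disc_measure) * cmod z ^ n"
        by simp
    qed
  qed (rule int)
  also have "(\<integral>w. (\<Sum>n. g w * (z * cnj w) ^ n) \<partial>disc_measure) = cauchy_transform g z"
    unfolding cauchy_transform_def
  proof (rule Bochner_Integration.integral_cong)
    fix w assume "w \<in> space disc_measure"
    then have "norm (z * cnj w) < 1" using norm_mult_cnj_less_1[OF z] by simp
    then show "(\<Sum>n. g w * (z * cnj w) ^ n) = g w / (1 - z * cnj w)"
      by (simp add: suminf_mult suminf_geometric summable_geometric)
  qed simp
  finally show "(\<lambda>n. (\<integral>w. g w * cnj w ^ n \<partial>disc_measure) * (z - 0) ^ n) sums cauchy_transform g z"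
    by (simp only: coeff)
qed

lemma measurable_disc_measure_continuous_on:
  fixes F :: "complex \<Rightarrow> complex"
  assumes "continuous_on (ball 0 1) F"
  shows "F \<in> borel_measurable disc_measure"
  using continuous_imp_measurable_on_sets_lebesgue[OF assms]
  by (simp add: measurable_cong_sets[OF sets_disc_measure refl])

text \<open>On the circle at height \<open>x\<close> the set has share at most
  \<open>min 1 ((m / x) powr q)\<close>, where \<open>m = M / \<mu>\<close>. Heights are uniformly
  distributed, so integration gives \<open>m + m / (q - 1)\<close>; the second summand is where
  \<open>q > 1\<close> enters.\<close>

lemma weak_type_of_circle_means:
  fixes q M \<mu> :: real and F :: "complex \<Rightarrow> complex"
  assumes q: "1 < q" and M: "0 < M" and \<mu>: "0 < \<mu>" and F: "continuous_on (ball 0 1) F"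
    and mean: "\<And>z. cmod z < 1 \<Longrightarrow> (\<integral>\<^sup>+\<theta>. ennreal (cmod (F (turn \<theta> * z)) powr q) \<partial>turn_measure) \<le> ennreal (M powr q)"
  shows "ennreal \<mu> * emeasure disc_measure {z. cmod z < 1 \<and> \<mu> * disc_height z < cmod (F z)}
     \<le> ennreal ((1 + 1 / (q - 1)) * M)"
proof -
  \<comment> \<open>Averaging over rotations asks for a Borel function on the whole plane, so
    \<open>F\<close> is cut off outside the disc.\<close>
  define G where "G z = (if z \<in> ball 0 1 then F z else 0)" for z
  have [measurable]: "G \<in> borel_measurable borel"
    unfolding G_def using F by (intro borel_measurable_continuous_on_if) auto
  let ?A = "{z. \<mu> * disc_height z < cmod (G z)}"
  define m where "m = M / \<mu>"
  have m: "0 < m" using M \<mu> by (simp add: m_def)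
  \<comment> \<open>\<open>x powr 0\<close> stands for 1, so that
    \<open>nn_integral_powr_near_0\<close> applies with exponent 0.\<close>
  let ?\<rho> = "\<lambda>x. (if x < m then ennreal (x powr 0) else 0) + ennreal (m powr q) * (if m \<le> x then ennreal (x powr - q) else 0)"
  have point: "(\<integral>\<^sup>+\<theta>. indicator ?A (turn \<theta> * z) \<partial>turn_measure) \<le> ?\<rho> (disc_height z)" if z: "cmod z < 1" for z
  proof -
    have pos: "0 < disc_height z" using z by (rule disc_height_pos)
    show ?thesis
    proof (cases "disc_height z < m")
      case True
      have "(\<integral>\<^sup>+\<theta>. indicator ?A (turn \<theta> * z) \<partial>turn_measure) \<le> (\<integral>\<^sup>+\<theta>. 1 \<partial>turn_measure)"
        by (intro nn_integral_mono) (auto simp: indicator_def)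
      then show ?thesis using True pos by simp
    next
      case False
      let ?l = "\<mu> * disc_height z"
      have l: "0 < ?l" using pos \<mu> by simp
      have "(\<integral>\<^sup>+\<theta>. indicator ?A (turn \<theta> * z) \<partial>turn_measure)
         \<le> (\<integral>\<^sup>+\<theta>. ennreal (?l powr - q) * ennreal (cmod (G (turn \<theta> * z)) powr q) \<partial>turn_measure)"
      proof (rule nn_integral_mono)
        fix \<theta>
        have "1 \<le> ?l powr - q * cmod (G (turn \<theta> * z)) powr q" if "turn \<theta> * z \<in> ?A"
        proof -
          have "?l powr - q * ?l powr q \<le> ?l powr - q * cmod (G (turn \<theta> * z)) powr q"
            using that l q by (intro mult_left_mono powr_mono2) auto
          then show ?thesis using \<mu> pos by (simp add: powr_add[symmetric])
        qed
        then show "indicator ?A (turn \<theta> * z) \<le> ennreal (?l powr - q) * ennreal (cmod (G (turn \<theta> * z)) powr q)"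
          by (auto simp: indicator_def ennreal_mult[symmetric])
      qed
      also have "\<dots> = ennreal (?l powr - q) * (\<integral>\<^sup>+\<theta>. ennreal (cmod (F (turn \<theta> * z)) powr q) \<partial>turn_measure)"
        using z by (subst nn_integral_cmult, measurable) (simp add: G_def norm_mult)
      also have "\<dots> \<le> ennreal (?l powr - q) * ennreal (M powr q)"
        by (intro mult_left_mono mean z) simp
      also have "\<dots> = ennreal (m powr q) * ennreal (disc_height z powr - q)"
        using M \<mu> pos by (simp add: ennreal_mult[symmetric] m_def powr_mult powr_divide powr_minus_divide)
      finally show ?thesis using False by simp
    qed
  qed
  have "emeasure disc_measure {z. cmod z < 1 \<and> \<mu> * disc_height z < cmod (F z)}
     = (\<integral>\<^sup>+z. indicator ?A z \<partial>disc_measure)"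
  proof -
    have "{z. cmod z < 1 \<and> \<mu> * disc_height z < cmod (F z)} = {z \<in> space disc_measure. \<mu> * disc_height z < cmod (G z)}"
      by (auto simp: G_def)
    moreover have "{z \<in> space disc_measure. \<mu> * disc_height z < cmod (G z)} \<in> sets disc_measure"
    proof -
      have [measurable]: "G \<in> borel_measurable disc_measure"
        by (rule borel_measurable_disc_measure) simp
      show ?thesis by measurable
    qed
    ultimately have "emeasure disc_measure {z. cmod z < 1 \<and> \<mu> * disc_height z < cmod (F z)}
       = (\<integral>\<^sup>+z. indicator {z \<in> space disc_measure. \<mu> * disc_height z < cmod (G z)} z \<partial>disc_measure)"
      by (simp only: nn_integral_indicator)
    also have "\<dots> = (\<integral>\<^sup>+z. indicator ?A z \<partial>disc_measure)"
      by (intro nn_integral_cong) (auto simp: indicator_def)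
    finally show ?thesis .
  qed
  also have "\<dots> = (\<integral>\<^sup>+z. (\<integral>\<^sup>+\<theta>. indicator ?A (turn \<theta> * z) \<partial>turn_measure) \<partial>disc_measure)"
    by (rule nn_integral_disc_turn_average) simp
  also have "\<dots> \<le> (\<integral>\<^sup>+z. ?\<rho> (disc_height z) \<partial>disc_measure)"
    by (intro nn_integral_mono point) simp
  also have "\<dots> = (\<integral>\<^sup>+x\<in>{0<..<1}. ?\<rho> x \<partial>lborel)"
    by (rule nn_integral_disc_height) measurable
  also have "\<dots> = (\<integral>\<^sup>+x. (if x < m then ennreal (x powr 0) else 0) * indicator {0<..<1} x
     + ennreal (m powr q) * ((if m \<le> x then ennreal (x powr - q) else 0) * indicator {0<..<1} x) \<partial>lborel)"
    by (intro nn_integral_cong) (auto simp: indicator_def)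
  also have "\<dots> = (\<integral>\<^sup>+x\<in>{0<..<1}. (if x < m then ennreal (x powr 0) else 0) \<partial>lborel)
     + (\<integral>\<^sup>+x. ennreal (m powr q) * ((if m \<le> x then ennreal (x powr - q) else 0) * indicator {0<..<1} x) \<partial>lborel)"
    by (rule nn_integral_add) measurable
  also have "\<dots> = (\<integral>\<^sup>+x\<in>{0<..<1}. (if x < m then ennreal (x powr 0) else 0) \<partial>lborel)
     + ennreal (m powr q) * (\<integral>\<^sup>+x\<in>{0<..<1}. (if m \<le> x then ennreal (x powr - q) else 0) \<partial>lborel)"
    by (intro arg_cong2[where f = "(+)"] refl nn_integral_cmult) measurable
  also have "\<dots> \<le> ennreal (m powr (0 + 1) / (0 + 1)) + ennreal (m powr q) * ennreal (m powr (- q + 1) / (- (- q) - 1))"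
    using m q by (intro add_mono mult_left_mono nn_integral_powr_near_0 nn_integral_powr_away_from_0) auto
  also have "\<dots> = ennreal ((1 + 1 / (q - 1)) * m)"
  proof -
    have "m powr q * m powr (- q + 1) = m" using m by (simp add: powr_add[symmetric])
    then have e: "m powr q * (m powr (- q + 1) / (- (- q) - 1)) = m / (q - 1)" by simp
    have "ennreal (m powr (0 + 1) / (0 + 1)) + ennreal (m powr q) * ennreal (m powr (- q + 1) / (- (- q) - 1))
        = ennreal m + ennreal (m / (q - 1))"
      using m q by (subst ennreal_mult[symmetric]) (simp_all only: e, simp_all)
    also have "\<dots> = ennreal (m + m / (q - 1))"
      using m q by (intro ennreal_plus[symmetric]) auto
    also have "m + m / (q - 1) = (1 + 1 / (q - 1)) * m" by (simp add: distrib_right)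
    finally show ?thesis .
  qed
  finally have "ennreal \<mu> * emeasure disc_measure {z. cmod z < 1 \<and> \<mu> * disc_height z < cmod (F z)}
     \<le> ennreal \<mu> * ennreal ((1 + 1 / (q - 1)) * m)"
    by (rule mult_left_mono) simp
  also have "\<dots> = ennreal ((1 + 1 / (q - 1)) * M)"
    using \<mu> q M by (subst ennreal_mult[symmetric]) (simp_all add: m_def)
  finally show ?thesis .
qed

section \<open>Weak type bound for Cauchy transforms of nonnegative densities\<close>

lemma height_poisson_eq_0:
  assumes b: "-1 < b" "b < 0" and f: "f \<in> borel_measurable disc_measure" "level_norm b f = 0" and z: "cmod z < 1"
  shows "height_poisson b f z = 0"
proof -
  have "level_poisson b f z = 0"
    using level_poisson_le[OF f(1) z, of b] f(2) by simp
  moreover have "height_poisson b f z \<le> ennreal (1 / (b + 1)) * level_norm b f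
     + (ennreal 1 * level_poisson b f z + ennreal (1 powr (1 - (1 - 2 / b)) / (- (b * (1 - 2 / b)) - 1)) * level_norm b f)"
    using b by (intro height_poisson_le f z) (auto simp: algebra_simps divide_le_0_iff)
  ultimately show ?thesis using f(2) by simp
qed

lemma integrable_height_powr:
  assumes b: "-1 < b" "b < 0" and f: "f \<in> borel_measurable disc_measure" "level_norm b f < \<infinity>"
    and nonneg: "\<And>w. 0 \<le> f w"
  shows "integrable disc_measure (\<lambda>w. f w * disc_height w powr b)"
proof (rule integrableI_nonneg)
  have [measurable]: "f \<in> borel_measurable disc_measure" by (rule f)
  show "(\<lambda>w. f w * disc_height w powr b) \<in> borel_measurable disc_measure" by measurable
  \<comment> \<open>The kernel is 1 at \<open>z = 0\<close>, so the total mass is a Poisson-type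
    integral at the origin.\<close>
  have "(\<integral>\<^sup>+w. ennreal (f w * disc_height w powr b) \<partial>disc_measure) = height_poisson b f 0"
    using nonneg by (simp add: height_poisson_def poisson_def ennreal_mult)
  also have "\<dots> < \<infinity>" by (rule height_poisson_finite[OF b f]) simp
  finally show "(\<integral>\<^sup>+w. ennreal (f w * disc_height w powr b) \<partial>disc_measure) < \<infinity>" .
qed (use nonneg in auto)

text \<open>Integrating \<open>2 / (1 - \<zeta>) - 1\<close> against the density gives twice the
  Cauchy transform minus the total mass, which is \<open>F 0\<close>; \<open>poisson_eq_Re\<close>
  identifies the real part.\<close>

lemma Re_cauchy_transform:
  assumes b: "-1 < b" "b < 0" and f: "f \<in> borel_measurable disc_measure" "level_norm b f < \<infinity>"
    and nonneg: "\<And>w. 0 \<le> f w" and z: "cmod z < 1"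
  defines "F \<equiv> cauchy_transform (\<lambda>w. of_real (f w * disc_height w powr b))"
  shows "Re (2 * F z - F 0) = enn2real (height_poisson b f z)"
proof -
  let ?g = "\<lambda>w. f w * disc_height w powr b"
  have [measurable]: "f \<in> borel_measurable disc_measure" by (rule f)
  have int: "integrable disc_measure (\<lambda>w. of_real (?g w) :: complex)"
    by (intro integrable_of_real integrable_height_powr b f nonneg)
  note iz = integrable_cauchy_kernel[OF int z]
  have i0: "integrable disc_measure (\<lambda>w. of_real (?g w) / (1 - 0 * cnj w) :: complex)"
    by (rule integrable_cauchy_kernel[OF int]) simp
  have "2 * F z - F 0 = (\<integral>w. 2 * (of_real (?g w) / (1 - z * cnj w)) - of_real (?g w) / (1 - 0 * cnj w) \<partial>disc_measure)"
    unfolding F_def cauchy_transform_def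
    by (simp only: Bochner_Integration.integral_diff[OF integrable_mult_right[OF iz] i0] integral_mult_right_zero)
  then have "Re (2 * F z - F 0) = (\<integral>w. Re (2 * (of_real (?g w) / (1 - z * cnj w)) - of_real (?g w) / (1 - 0 * cnj w)) \<partial>disc_measure)"
    using integral_Re[OF Bochner_Integration.integrable_diff[OF integrable_mult_right[OF iz] i0]] by simp
  also have "\<dots> = (\<integral>w. ?g w * poisson (z * cnj w) \<partial>disc_measure)"
  proof (rule Bochner_Integration.integral_cong)
    fix w assume "w \<in> space disc_measure"
    then have "cmod (z * cnj w) < 1" using norm_mult_cnj_less_1[OF z] by simp
    then have "z * cnj w \<noteq> 1" by auto
    then have "poisson (z * cnj w) = Re (2 / (1 - z * cnj w) - 1)" by (rule poisson_eq_Re)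
    moreover have "2 * (of_real (?g w) / (1 - z * cnj w)) - of_real (?g w) / (1 - 0 * cnj w)
        = of_real (?g w) * (2 / (1 - z * cnj w) - 1)"
      by (simp add: right_diff_distrib)
    ultimately show "Re (2 * (of_real (?g w) / (1 - z * cnj w)) - of_real (?g w) / (1 - 0 * cnj w))
        = ?g w * poisson (z * cnj w)"
      by (simp only: Re_complex_of_real Im_complex_of_real times_complex.sel)
  qed simp
  also have "\<dots> = enn2real (\<integral>\<^sup>+w. ennreal (?g w * poisson (z * cnj w)) \<partial>disc_measure)"
  proof (rule integral_eq_nn_integral)
    show "AE w in disc_measure. 0 \<le> ?g w * poisson (z * cnj w)"
      using nonneg poisson_nonneg norm_mult_cnj_less_1[OF z] by (intro AE_I2) auto
  qed measurable
  also have "(\<integral>\<^sup>+w. ennreal (?g w * poisson (z * cnj w)) \<partial>disc_measure) = height_poisson b f z"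
    unfolding height_poisson_def using nonneg by (simp add: ennreal_mult' mult.assoc)
  finally show ?thesis .
qed

lemma cauchy_transform_weak_type:
  fixes b :: real
  assumes b: "-1 < b" "b < 0"
  obtains C :: real where "0 \<le> C"
    "\<And>f \<mu>. f \<in> borel_measurable disc_measure \<Longrightarrow> level_norm b f < \<infinity> \<Longrightarrow> (\<And>w. 0 \<le> f w) \<Longrightarrow> 0 < \<mu> \<Longrightarrow>
      ennreal \<mu> * emeasure disc_measure
          {z. cmod z < 1 \<and> \<mu> * disc_height z < cmod (cauchy_transform (\<lambda>w. of_real (f w * disc_height w powr b)) z)}
        \<le> ennreal C * level_norm b f"
proof -
  have "1 < min 2 (1 / (b + 1))" using b by simp
  then obtain q where "1 < q" "q < min 2 (1 / (b + 1))" using dense by blast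
  then have q: "1 < q" "q < 2" and qb: "q * (b + 1) < 1"
    using b by (auto simp: field_simps)
  obtain C where C: "0 < C" and height_C: "\<And>f z. f \<in> borel_measurable disc_measure \<Longrightarrow> level_norm b f < \<infinity> \<Longrightarrow>
      0 < level_norm b f \<Longrightarrow> cmod z < 1 \<Longrightarrow>
      (\<integral>\<^sup>+\<theta>. ennreal (enn2real (height_poisson b f (turn \<theta> * z)) powr q) \<partial>turn_measure)
        \<le> ennreal (C * enn2real (level_norm b f) powr q)"
    using nn_integral_height_poisson_powr_turn_le[OF b q(1) qb] by blast
  obtain A where A: "0 \<le> A" and riesz: "\<And>H z. H holomorphic_on ball 0 1 \<Longrightarrow>
       (\<And>z. cmod z < 1 \<Longrightarrow> 0 < Re (H z)) \<Longrightarrow> Im (H 0) = 0 \<Longrightarrow> cmod z < 1 \<Longrightarrow>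
       (\<integral>\<^sup>+\<theta>. ennreal (cmod (H (turn \<theta> * z)) powr q) \<partial>turn_measure)
         \<le> ennreal A * (\<integral>\<^sup>+\<theta>. ennreal (Re (H (turn \<theta> * z)) powr q) \<partial>turn_measure)"
    using nn_integral_turn_powr_le[OF q] by blast
  \<comment> \<open>In \<open>K powr q = (A + 1) * C\<close> the summand \<open>A * C\<close> pays
    for \<open>H\<close> and the extra \<open>C\<close> for the constant \<open>F 0\<close>.\<close>
  define K where "K = ((A + 1) * C) powr (1 / q)"
  have K: "0 < K" "K powr q = (A + 1) * C"
    using A C q by (auto simp: K_def powr_powr)
  show thesis
  proof (rule that)
    show "0 \<le> (1 + 1 / (q - 1)) * K" using q K by simp
  next
    fix f :: "complex \<Rightarrow> real" and \<mu> :: real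
    assume f: "f \<in> borel_measurable disc_measure" and fin: "level_norm b f < \<infinity>"
      and nonneg: "\<And>w. 0 \<le> f w" and \<mu>: "0 < \<mu>"
    let ?g = "\<lambda>w. f w * disc_height w powr b"
    define F where "F = cauchy_transform (\<lambda>w. of_real (?g w))"
    have int: "integrable disc_measure (\<lambda>w. of_real (?g w) :: complex)"
      by (intro integrable_of_real integrable_height_powr b f fin nonneg)
    have holF: "F holomorphic_on ball 0 1"
      unfolding F_def by (rule holomorphic_cauchy_transform[OF int])
    have F0: "F 0 = of_real (\<integral>w. ?g w \<partial>disc_measure)"
    proof -
      have "F 0 = (\<integral>w. of_real (?g w) \<partial>disc_measure)"
        unfolding F_def cauchy_transform_def by (intro Bochner_Integration.integral_cong) simp_all
      then show ?thesis by (simp only: integral_complex_of_real)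
    qed
    have g0: "0 \<le> (\<integral>w. ?g w \<partial>disc_measure)"
      using nonneg by (intro Bochner_Integration.integral_nonneg) auto
    show "ennreal \<mu> * emeasure disc_measure
          {z. cmod z < 1 \<and> \<mu> * disc_height z < cmod (cauchy_transform (\<lambda>w. of_real (?g w)) z)}
        \<le> ennreal ((1 + 1 / (q - 1)) * K) * level_norm b f"
      unfolding F_def[symmetric]
    \<comment> \<open>Zero mass is split off because \<open>H\<close> then vanishes, while Riesz's
      inequality wants a strictly positive real part.\<close>
    proof (cases "(\<integral>w. ?g w \<partial>disc_measure) = 0")
      case True
      then have "AE w in disc_measure. ?g w = 0"
        using nonneg by (subst (asm) integral_nonneg_eq_0_iff_AE[OF integrable_height_powr[OF b f fin nonneg]]) auto
      then have "F z = 0" for z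
        unfolding F_def cauchy_transform_def by (intro integral_eq_zero_AE) auto
      then have "{z. cmod z < 1 \<and> \<mu> * disc_height z < cmod (F z)} = {}"
        using \<mu> disc_height_pos by (force simp: mult_less_0_iff)
      then show "ennreal \<mu> * emeasure disc_measure {z. cmod z < 1 \<and> \<mu> * disc_height z < cmod (F z)}
        \<le> ennreal ((1 + 1 / (q - 1)) * K) * level_norm b f"
        by (simp only: emeasure_empty mult_zero_right zero_le)
    next
      case False
      define H where "H z = 2 * F z - F 0" for z
      have ReH: "Re (H z) = enn2real (height_poisson b f z)" if "cmod z < 1" for z
        unfolding H_def F_def by (rule Re_cauchy_transform[OF b f fin nonneg that])
      have H0: "H 0 = F 0" by (simp add: H_def)
      have n: "0 < level_norm b f"
        using height_poisson_eq_0[OF b f, of 0] ReH[of 0] False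
        by (auto simp: H0 F0 zero_less_iff_neq_zero)
      have holH: "H holomorphic_on ball 0 1"
        unfolding H_def by (intro holomorphic_intros holF)
      \<comment> \<open>Harnack: the real part is positive at 0, where it is the total mass, and the
        lower bound on the kernel carries this to \<open>z\<close>.\<close>
      have posH: "0 < Re (H z)" if z: "cmod z < 1" for z
      proof -
        have "ennreal ((1 - cmod z) / 2) * height_poisson b f 0 \<le> height_poisson b f z"
        proof -
          have "ennreal ((1 - cmod z) / 2) * height_poisson b f 0
             = (\<integral>\<^sup>+w. ennreal ((1 - cmod z) / 2) * (ennreal (f w) * ennreal (disc_height w powr b)) \<partial>disc_measure)"
            unfolding height_poisson_def using f by (simp add: poisson_def nn_integral_cmult)
          also have "\<dots> \<le> height_poisson b f z"
            unfolding height_poisson_def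
          proof (rule nn_integral_mono)
            fix w assume "w \<in> space disc_measure"
            then have w: "cmod w < 1" by simp
            have "(1 - cmod z) / 2 \<le> (1 - cmod (z * cnj w)) / 2"
              using w by (simp add: norm_mult mult_left_le)
            also have "\<dots> \<le> poisson (z * cnj w)"
              by (rule poisson_lower_bound[OF norm_mult_cnj_less_1[OF z w]])
            finally have "(1 - cmod z) / 2 * (f w * disc_height w powr b) \<le> poisson (z * cnj w) * (f w * disc_height w powr b)"
              using nonneg by (intro mult_right_mono) auto
            then show "ennreal ((1 - cmod z) / 2) * (ennreal (f w) * ennreal (disc_height w powr b))
                \<le> ennreal (f w) * ennreal (disc_height w powr b * poisson (z * cnj w))"
              using nonneg z poisson_nonneg[OF norm_mult_cnj_less_1[OF z w]]
              by (simp add: ennreal_mult[symmetric] mult_ac)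
          qed
          finally show ?thesis .
        qed
        moreover have "0 < height_poisson b f 0"
          using ReH[of 0] False g0 by (auto simp: H0 F0 zero_less_iff_neq_zero)
        ultimately have "0 < height_poisson b f z"
          using z by (auto simp: zero_less_iff_neq_zero)
        then show ?thesis
          using height_poisson_finite[OF b f fin z] by (simp add: ReH[OF z] enn2real_positive_iff)
      qed
      define N where "N = enn2real (level_norm b f)"
      have N: "level_norm b f = ennreal N" "0 < N"
        using fin n by (auto simp: N_def enn2real_positive_iff)
      have mean: "(\<integral>\<^sup>+\<theta>. ennreal (cmod (F (turn \<theta> * z)) powr q) \<partial>turn_measure) \<le> ennreal ((K * N) powr q)"
        if z: "cmod z < 1" for z
      proof -
        have less: "cmod (turn \<theta> * z) < 1" for \<theta> using z by (simp add: norm_mult)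
        have h: "(\<integral>\<^sup>+\<theta>. ennreal (Re (H (turn \<theta> * z)) powr q) \<partial>turn_measure) \<le> ennreal (C * N powr q)"
          if "cmod z < 1" for z
          using height_C[OF f fin n that] that by (simp add: ReH norm_mult N_def)
        \<comment> \<open>The mean bound at \<open>z = 0\<close> bounds the value there, since the
          circle degenerates to a point and the angular measure has mass 1.\<close>
        have "cmod (F 0) = Re (H 0)" using g0 by (simp add: H0 F0)
        then have c: "ennreal (cmod (F 0) powr q) \<le> ennreal (C * N powr q)"
          using h[of 0] by simp
        \<comment> \<open>\<open>F w\<close> is the average of \<open>H w\<close> and
          \<open>F 0\<close>, so its modulus is at most the larger of theirs and no power of 2 is
          lost.\<close>
        have "cmod (F w) powr q \<le> cmod (H w) powr q + cmod (F 0) powr q" for w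
        proof -
          have "2 * F w = H w + F 0" by (simp add: H_def)
          then have "2 * cmod (F w) \<le> cmod (H w) + cmod (F 0)"
            by (metis norm_mult norm_numeral norm_triangle_ineq)
          then have "cmod (F w) \<le> max (cmod (H w)) (cmod (F 0))" by linarith
          then have "cmod (F w) powr q \<le> max (cmod (H w)) (cmod (F 0)) powr q"
            using q by (intro powr_mono2) auto
          also have "\<dots> \<le> cmod (H w) powr q + cmod (F 0) powr q" by (auto simp: max_def)
          finally show ?thesis .
        qed
        then have "(\<integral>\<^sup>+\<theta>. ennreal (cmod (F (turn \<theta> * z)) powr q) \<partial>turn_measure)
           \<le> (\<integral>\<^sup>+\<theta>. ennreal (cmod (H (turn \<theta> * z)) powr q) + ennreal (cmod (F 0) powr q) \<partial>turn_measure)"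
          by (intro nn_integral_mono) (simp add: ennreal_plus[symmetric] del: ennreal_plus)
        also have "\<dots> = (\<integral>\<^sup>+\<theta>. ennreal (cmod (H (turn \<theta> * z)) powr q) \<partial>turn_measure) + ennreal (cmod (F 0) powr q)"
        proof -
          have "integrable turn_measure (\<lambda>\<theta>. H (turn \<theta> * z))"
            by (rule integrable_turn_measure(1)[OF holomorphic_on_imp_continuous_on[OF holH] z])
          then have [measurable]: "(\<lambda>\<theta>. H (turn \<theta> * z)) \<in> borel_measurable turn_measure" by auto
          show ?thesis by (subst nn_integral_add) auto
        qed
        also have "\<dots> \<le> ennreal A * (\<integral>\<^sup>+\<theta>. ennreal (Re (H (turn \<theta> * z)) powr q) \<partial>turn_measure) + ennreal (C * N powr q)"
          using g0 by (intro add_mono riesz holH posH z c) (auto simp: H0 F0)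
        also have "\<dots> \<le> ennreal A * ennreal (C * N powr q) + ennreal (C * N powr q)"
          by (intro add_mono mult_left_mono h z) auto
        also have "\<dots> = ennreal (A * (C * N powr q) + C * N powr q)"
          using A C by (simp add: ennreal_mult)
        also have "A * (C * N powr q) + C * N powr q = (K * N) powr q"
          using K N by (simp add: powr_mult algebra_simps)
        finally show ?thesis .
      qed
      have "ennreal \<mu> * emeasure disc_measure {z. cmod z < 1 \<and> \<mu> * disc_height z < cmod (F z)}
          \<le> ennreal ((1 + 1 / (q - 1)) * (K * N))"
        using K N by (intro weak_type_of_circle_means q \<mu> mean holomorphic_on_imp_continuous_on[OF holF]) auto
      also have "\<dots> = ennreal ((1 + 1 / (q - 1)) * K) * level_norm b f"
        using q K N by (simp add: ennreal_mult[symmetric] mult.assoc)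
      finally show "ennreal \<mu> * emeasure disc_measure {z. cmod z < 1 \<and> \<mu> * disc_height z < cmod (F z)}
        \<le> ennreal ((1 + 1 / (q - 1)) * K) * level_norm b f" .
    qed
  qed
qed

section \<open>The operator with the modulus kernel is unbounded\<close>

lemma nn_integral_lborel_shift:
  fixes f :: "real \<Rightarrow> ennreal"
  assumes "f \<in> borel_measurable borel"
  shows "(\<integral>\<^sup>+x. f (x + a) \<partial>lborel) = (\<integral>\<^sup>+x. f x \<partial>lborel)"
  using nn_integral_real_affine[OF assms, of 1 a] by (simp add: add.commute)

text \<open>With \<open>u = turn a\<close> the rotation shifts the angle by \<open>a\<close>, and
  periodicity moves the part beyond 1 back to \<open>{0<..a}\<close>.\<close>

lemma nn_integral_turn_shift:
  fixes f :: "complex \<Rightarrow> ennreal"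
  assumes [measurable]: "f \<in> borel_measurable borel" and u: "cmod u = 1"
  shows "(\<integral>\<^sup>+\<theta>. f (turn \<theta> * u) \<partial>turn_measure) = (\<integral>\<^sup>+\<theta>. f (turn \<theta>) \<partial>turn_measure)"
proof -
  define a where "a = Arg2pi u / (2 * pi)"
  have a: "0 \<le> a" "a < 1" using Arg2pi[of u] by (auto simp: a_def)
  have "u = turn a"
    using Arg2pi[of u] u by (simp add: is_Arg_def a_def turn_def cis_conv_exp)
  then have add: "turn \<theta> * u = turn (\<theta> + a)" for \<theta>
    by (simp add: turn_def cis_mult distrib_left)
  define g where "g \<theta> = f (turn \<theta>)" for \<theta>
  have [measurable]: "g \<in> borel_measurable borel" unfolding g_def by measurable
  have per: "g (\<theta> + 1) = g \<theta>" for \<theta>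
    by (simp add: g_def turn_def distrib_left cis_mult[symmetric])
  \<comment> \<open>Half-open intervals make the pieces of the shifted period disjoint.\<close>
  have turn_int: "(\<integral>\<^sup>+\<theta>. h \<theta> \<partial>turn_measure) = (\<integral>\<^sup>+x\<in>{0<..1}. h x \<partial>lborel)"
    if [measurable]: "h \<in> borel_measurable borel" for h
  proof -
    have "(\<integral>\<^sup>+\<theta>. h \<theta> \<partial>turn_measure) = (\<integral>\<^sup>+x\<in>{0..1}. h x \<partial>lborel)"
      by (simp add: turn_measure_def nn_integral_density mult.commute)
    also have "\<dots> = (\<integral>\<^sup>+x\<in>{0<..1}. h x \<partial>lborel)"
      by (rule nn_integral_cong_AE)
         (use AE_lborel_singleton[of 0] in eventually_elim, auto simp: indicator_def)
    finally show ?thesis .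
  qed
  have "(\<integral>\<^sup>+\<theta>. f (turn \<theta> * u) \<partial>turn_measure) = (\<integral>\<^sup>+x\<in>{0<..1}. g (x + a) \<partial>lborel)"
    unfolding add g_def by (rule turn_int) measurable
  also have "\<dots> = (\<integral>\<^sup>+x. g (x + a) * indicator {a<..1 + a} (x + a) \<partial>lborel)"
    by (intro nn_integral_cong) (auto simp: indicator_def)
  also have "\<dots> = (\<integral>\<^sup>+x. g x * indicator {a<..1 + a} x \<partial>lborel)"
    by (rule nn_integral_lborel_shift) measurable
  also have "\<dots> = (\<integral>\<^sup>+x. g x * indicator {a<..1} x + g x * indicator {1<..1 + a} x \<partial>lborel)"
    using a by (intro nn_integral_cong) (auto simp: indicator_def)
  also have "\<dots> = (\<integral>\<^sup>+x. g x * indicator {a<..1} x \<partial>lborel) + (\<integral>\<^sup>+x. g x * indicator {1<..1 + a} x \<partial>lborel)"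
    by (rule nn_integral_add) measurable
  also have "(\<integral>\<^sup>+x. g x * indicator {1<..1 + a} x \<partial>lborel) = (\<integral>\<^sup>+x. g (x + 1) * indicator {1<..1 + a} (x + 1) \<partial>lborel)"
    by (rule nn_integral_lborel_shift[symmetric]) measurable
  also have "\<dots> = (\<integral>\<^sup>+x. g x * indicator {0<..a} x \<partial>lborel)"
    by (intro nn_integral_cong) (auto simp: indicator_def per)
  also have "(\<integral>\<^sup>+x. g x * indicator {a<..1} x \<partial>lborel) + (\<integral>\<^sup>+x. g x * indicator {0<..a} x \<partial>lborel)
      = (\<integral>\<^sup>+x. g x * indicator {a<..1} x + g x * indicator {0<..a} x \<partial>lborel)"
    by (rule nn_integral_add[symmetric]) measurable
  also have "\<dots> = (\<integral>\<^sup>+x\<in>{0<..1}. g x \<partial>lborel)"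
    using a by (intro nn_integral_cong) (auto simp: indicator_def)
  also have "\<dots> = (\<integral>\<^sup>+\<theta>. f (turn \<theta>) \<partial>turn_measure)"
    unfolding g_def by (rule turn_int[symmetric]) measurable
  finally show ?thesis .
qed

lemma norm_one_minus_turn_le:
  assumes "0 \<le> \<rho>" "\<rho> \<le> 1" "0 \<le> \<theta>"
  shows "cmod (1 - turn \<theta> * of_real \<rho>) \<le> (1 - \<rho>) + 2 * pi * \<theta>"
proof -
  have "1 - turn \<theta> * of_real \<rho> = of_real (1 - \<rho>) - of_real \<rho> * (turn \<theta> - 1)"
    by (simp add: algebra_simps)
  then have "cmod (1 - turn \<theta> * of_real \<rho>) \<le> cmod (of_real (1 - \<rho>)) + cmod (of_real \<rho> * (turn \<theta> - 1))"
    by (metis norm_triangle_ineq4)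
  also have "cmod (of_real (1 - \<rho>)) = 1 - \<rho>" using assms by (simp del: of_real_diff)
  also have "cmod (of_real \<rho> * (turn \<theta> - 1)) \<le> 1 * (2 * pi * \<theta>)"
  proof -
    have "cmod (turn \<theta> - 1) = 2 * \<bar>sin (2 * pi * \<theta> / 2)\<bar>"
      unfolding turn_def cis_conv_exp by (rule dist_exp_i_1)
    also have "\<dots> \<le> 2 * \<bar>2 * pi * \<theta> / 2\<bar>" by (intro mult_left_mono abs_sin_x_le_abs_x) simp
    finally have "cmod (turn \<theta> - 1) \<le> 2 * pi * \<theta>" using assms by simp
    then show ?thesis using assms unfolding norm_mult by (intro mult_mono) auto
  qed
  finally show ?thesis by simp
qed

text \<open>The distance is at most \<open>1 - |\<zeta>| + 2 * pi * \<theta>\<close>, and the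
  reciprocal of this integrates to a logarithm. The parameter \<open>d\<close> gives one bound for
  all \<open>\<zeta>\<close> at distance at most \<open>d\<close> from the circle, hence for a whole
  annulus.\<close>

lemma nn_integral_inverse_norm_turn_ge:
  assumes \<zeta>: "cmod \<zeta> < 1" and d: "1 - cmod \<zeta> \<le> d" "d \<le> 1"
  shows "ennreal (ln (1 / d) / (2 * pi)) \<le> (\<integral>\<^sup>+\<theta>. ennreal (1 / cmod (1 - turn \<theta> * \<zeta>)) \<partial>turn_measure)"
proof -
  define \<rho> where "\<rho> = cmod \<zeta>"
  have \<rho>: "0 \<le> \<rho>" "\<rho> < 1" "1 - \<rho> \<le> d" using \<zeta> d by (auto simp: \<rho>_def)
  \<comment> \<open>The direction of \<open>\<zeta>\<close>, removed at the end by rotation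
    invariance; at \<open>\<zeta> = 0\<close> any unit number would do.\<close>
  define u where "u = (if \<zeta> = 0 then 1 else \<zeta> / of_real \<rho>)"
  have u: "cmod u = 1" "\<zeta> = u * of_real \<rho>"
    by (auto simp: u_def \<rho>_def norm_divide)
  let ?F = "\<lambda>x. ln ((1 - \<rho>) + 2 * pi * x) / (2 * pi)"
  have "ennreal (ln (1 / d) / (2 * pi)) \<le> ennreal (?F 1 - ?F 0)"
  proof (rule ennreal_leI)
    have "ln (1 / d) \<le> ln (1 / (1 - \<rho>))" using \<rho> d by (subst ln_le_cancel_iff) (auto intro: divide_left_mono)
    also have "\<dots> \<le> ln ((1 - \<rho>) + 2 * pi * 1) - ln ((1 - \<rho>) + 2 * pi * 0)"
    proof -
      have "1 \<le> 2 * pi" using pi_gt3 by linarith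
      then have "0 \<le> ln ((1 - \<rho>) + 2 * pi)" using \<rho> by (intro ln_ge_zero) linarith
      then show ?thesis using \<rho> by (simp add: ln_div)
    qed
    finally show "ln (1 / d) / (2 * pi) \<le> ?F 1 - ?F 0"
      unfolding diff_divide_distrib[symmetric] by (intro divide_right_mono) auto
  qed
  also have "ennreal (?F 1 - ?F 0)
      = (\<integral>\<^sup>+x. ennreal (1 / ((1 - \<rho>) + 2 * pi * x)) * indicator {0..1} x \<partial>lborel)"
  proof (rule nn_integral_FTC_Icc[symmetric])
    fix x :: real assume "x \<in> {0..1}"
    then have pos: "0 < (1 - \<rho>) + 2 * pi * x" using \<rho> by (intro add_pos_nonneg) auto
    then show "0 \<le> 1 / ((1 - \<rho>) + 2 * pi * x)" by simp
    show "DERIV ?F x :> 1 / ((1 - \<rho>) + 2 * pi * x)"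
      using pos by (auto intro!: derivative_eq_intros)
  qed simp_all
  also have "\<dots> \<le> (\<integral>\<^sup>+x. ennreal (1 / cmod (1 - turn x * of_real \<rho>)) * indicator {0..1} x \<partial>lborel)"
  proof (rule nn_integral_mono)
    fix x :: real
    show "ennreal (1 / ((1 - \<rho>) + 2 * pi * x)) * indicator {0..1} x
        \<le> ennreal (1 / cmod (1 - turn x * of_real \<rho>)) * indicator {0..1} x"
    proof (cases "x \<in> {0..1}")
      case True
      have "cmod (turn x * of_real \<rho>) < 1" using \<rho> by (simp add: norm_mult)
      then have "0 < cmod (1 - turn x * of_real \<rho>)" by auto
      then show ?thesis
        using True norm_one_minus_turn_le[of \<rho> x] \<rho>
        by (auto intro!: ennreal_leI divide_left_mono mult_pos_pos add_pos_nonneg)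
    qed simp
  qed
  also have "\<dots> = (\<integral>\<^sup>+\<theta>. ennreal (1 / cmod (1 - turn \<theta> * of_real \<rho>)) \<partial>turn_measure)"
    by (simp add: turn_measure_def nn_integral_density mult.commute)
  also have "\<dots> = (\<integral>\<^sup>+\<theta>. ennreal (1 / cmod (1 - turn \<theta> * u * of_real \<rho>)) \<partial>turn_measure)"
    by (rule nn_integral_turn_shift[OF _ u(1), symmetric, of "\<lambda>w. ennreal (1 / cmod (1 - w * of_real \<rho>))"]) measurable
  finally show ?thesis by (simp add: u(2) mult.assoc)
qed

text \<open>Where \<open>h(w) < m \<le> h(z)\<close> one has \<open>|w| \<ge> |z|\<close>, hence
  \<open>1 - |w| * |z| \<le> h(z)\<close>, and the circle through \<open>w\<close> has mean at least
  \<open>ln (1 / h(z)) / (2 * pi)\<close>. The annulus has measure \<open>m\<close>, and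
  \<open>h powr b \<ge> m powr b\<close> on it since \<open>b \<le> 0\<close>.\<close>

lemma nn_integral_annulus_inverse_norm_ge:
  assumes b: "b \<le> 0" and m: "0 < m" "m \<le> disc_height z" and z: "cmod z < 1"
  shows "ennreal (m powr (b + 1) * (ln (1 / disc_height z) / (2 * pi)))
    \<le> (\<integral>\<^sup>+w. ennreal ((if disc_height w < m then disc_height w powr b else 0) / cmod (1 - z * cnj w)) \<partial>disc_measure)"
proof -
  let ?r = "\<lambda>x. if x < m then x powr b else 0"
  have rot: "cmod (1 - z * cnj (turn \<theta> * w)) = cmod (1 - turn \<theta> * (w * cnj z))" for \<theta> w
  proof -
    have "cnj (1 - z * cnj (turn \<theta> * w)) = 1 - turn \<theta> * (w * cnj z)" by (simp add: mult_ac)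
    then show ?thesis by (metis complex_mod_cnj)
  qed
  have h1: "disc_height z \<le> 1" by (simp add: disc_height_def)
  with m have m1: "m \<le> 1" by simp
  have l: "0 \<le> ln (1 / disc_height z) / (2 * pi)"
    using h1 disc_height_pos[OF z] by simp
  have "ennreal (m powr (b + 1) * (ln (1 / disc_height z) / (2 * pi)))
      = ennreal (ln (1 / disc_height z) / (2 * pi)) * ennreal (m powr b * m)"
  proof -
    have "m powr (b + 1) = m powr b * m" using m by (simp add: powr_mult_self)
    then show ?thesis using m l by (simp only:) (subst ennreal_mult[symmetric], auto simp: mult_ac)
  qed
  also have "ennreal (m powr b * m) = ennreal (m powr b) * emeasure lborel {0<..<m}"
    using m by (simp add: ennreal_mult)
  also have "ennreal (m powr b) * emeasure lborel {0<..<m} = (\<integral>\<^sup>+x. ennreal (m powr b) * indicator {0<..<m} x \<partial>lborel)"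
    by (rule nn_integral_cmult_indicator[symmetric]) simp
  also have "\<dots> \<le> (\<integral>\<^sup>+x\<in>{0<..<1}. ennreal (?r x) \<partial>lborel)"
    using m1 b by (intro nn_integral_mono) (auto simp: indicator_def intro!: powr_mono2' ennreal_leI)
  also have "\<dots> = (\<integral>\<^sup>+w. ennreal (?r (disc_height w)) \<partial>disc_measure)"
    by (rule nn_integral_disc_height[symmetric]) measurable
  also have "ennreal (ln (1 / disc_height z) / (2 * pi)) * \<dots>
     = (\<integral>\<^sup>+w. ennreal (ln (1 / disc_height z) / (2 * pi)) * ennreal (?r (disc_height w)) \<partial>disc_measure)"
    by (rule nn_integral_cmult[symmetric]) measurable
  also have "\<dots> \<le> (\<integral>\<^sup>+w. (\<integral>\<^sup>+\<theta>. ennreal (?r (disc_height w) / cmod (1 - turn \<theta> * (w * cnj z))) \<partial>turn_measure) \<partial>disc_measure)"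
  proof (rule nn_integral_mono)
    fix w assume "w \<in> space disc_measure"
    then have w: "cmod w < 1" by simp
    have "(\<integral>\<^sup>+\<theta>. ennreal (?r (disc_height w) / cmod (1 - turn \<theta> * (w * cnj z))) \<partial>turn_measure)
       = (\<integral>\<^sup>+\<theta>. ennreal (?r (disc_height w)) * ennreal (1 / cmod (1 - turn \<theta> * (w * cnj z))) \<partial>turn_measure)"
      by (intro nn_integral_cong) (simp add: ennreal_mult[symmetric])
    also have "\<dots> = ennreal (?r (disc_height w)) * (\<integral>\<^sup>+\<theta>. ennreal (1 / cmod (1 - turn \<theta> * (w * cnj z))) \<partial>turn_measure)"
      by (rule nn_integral_cmult) measurable
    finally have eq: "(\<integral>\<^sup>+\<theta>. ennreal (?r (disc_height w) / cmod (1 - turn \<theta> * (w * cnj z))) \<partial>turn_measure)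
       = ennreal (?r (disc_height w)) * (\<integral>\<^sup>+\<theta>. ennreal (1 / cmod (1 - turn \<theta> * (w * cnj z))) \<partial>turn_measure)" .
    show "ennreal (ln (1 / disc_height z) / (2 * pi)) * ennreal (?r (disc_height w))
       \<le> (\<integral>\<^sup>+\<theta>. ennreal (?r (disc_height w) / cmod (1 - turn \<theta> * (w * cnj z))) \<partial>turn_measure)"
    proof (cases "disc_height w < m")
      case True
      have "(cmod z)\<^sup>2 \<le> (cmod w)\<^sup>2" using True m unfolding disc_height_def by linarith
      then have "cmod z \<le> cmod w" by (rule power2_le_imp_le) simp
      then have "(cmod z)\<^sup>2 \<le> cmod (w * cnj z)"
        by (simp add: norm_mult power2_eq_square mult_right_mono)
      then have "1 - cmod (w * cnj z) \<le> disc_height z" by (simp add: disc_height_def)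
      then have "ennreal (ln (1 / disc_height z) / (2 * pi)) \<le> (\<integral>\<^sup>+\<theta>. ennreal (1 / cmod (1 - turn \<theta> * (w * cnj z))) \<partial>turn_measure)"
        by (intro nn_integral_inverse_norm_turn_ge norm_mult_cnj_less_1 w z h1)
      then show ?thesis unfolding eq by (subst mult.commute) (rule mult_left_mono, simp_all)
    qed simp
  qed
  also have "\<dots> = (\<integral>\<^sup>+w. ennreal (?r (disc_height w) / cmod (1 - z * cnj w)) \<partial>disc_measure)"
    by (subst nn_integral_disc_turn_average[of "\<lambda>w. ennreal (?r (disc_height w) / cmod (1 - z * cnj w))"], measurable)
       (simp only: rot disc_height_turn)
  finally show ?thesis by (simp add: mult_left_mono)
qed

section \<open>Testing on thin annuli\<close>

lemma S_kernel_eq: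
  "S_kernel b 1 z w = of_real (disc_height w powr b / cmod (1 - z * cnj w))" if "cmod z < 1" "cmod w < 1"
proof -
  have "1 - z * cnj w \<noteq> 0" using norm_mult_cnj_less_1[OF that] by auto
  then show ?thesis by (simp add: S_kernel_def disc_height_def)
qed

lemma emeasure_disc_height:
  assumes [measurable]: "A \<in> sets borel" and "A \<subseteq> {0<..<1}"
  shows "emeasure disc_measure {z. cmod z < 1 \<and> disc_height z \<in> A} = emeasure lborel A"
proof -
  have set: "{z \<in> space disc_measure. disc_height z \<in> A} \<in> sets disc_measure" by measurable
  have "emeasure disc_measure {z. cmod z < 1 \<and> disc_height z \<in> A}
     = (\<integral>\<^sup>+z. indicator {z \<in> space disc_measure. disc_height z \<in> A} z \<partial>disc_measure)"
    using nn_integral_indicator[OF set] by simp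
  also have "\<dots> = (\<integral>\<^sup>+z. indicator A (disc_height z) \<partial>disc_measure)"
    by (intro nn_integral_cong) (auto simp: indicator_def)
  also have "\<dots> = (\<integral>\<^sup>+x\<in>{0<..<1}. indicator A x \<partial>lborel)"
    by (rule nn_integral_disc_height) measurable
  also have "\<dots> = (\<integral>\<^sup>+x. indicator A x \<partial>lborel)"
    using assms(2) by (intro nn_integral_cong) (auto simp: indicator_def)
  finally show ?thesis by simp
qed

definition annulus_indicator :: "real \<Rightarrow> complex \<Rightarrow> complex" where
  "annulus_indicator m w = (if disc_height w < m then 1 else 0)"

lemma lorentz_p1_norm_annulus_indicator:
  assumes b: "-1 < b" and m: "0 < m" "m < 1"
  shows "lorentz_p1_norm (1 / (b + 1)) (annulus_indicator m) = ennreal (1 / (b + 1) * m powr (b + 1))"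
proof -
  have dist: "distribution_fun (annulus_indicator m) t = (if t < 1 then ennreal m else 0)" if "0 < t" for t
  proof (cases "t < 1")
    case True
    have eq: "{z \<in> ball 0 1. cmod (annulus_indicator m z) > t} = {z. cmod z < 1 \<and> disc_height z \<in> {0<..<m}}"
      using that True disc_height_pos by (auto simp: annulus_indicator_def)
    show ?thesis
      using True m unfolding distribution_fun_def eq by (subst emeasure_disc_height) auto
  next
    case False
    then have eq: "{z \<in> ball 0 1. cmod (annulus_indicator m z) > t} = {}"
      by (auto simp: annulus_indicator_def)
    show ?thesis using False unfolding distribution_fun_def eq by simp
  qed
  have "(\<integral>\<^sup>+t\<in>{0<..}. ennreal (enn2real (distribution_fun (annulus_indicator m) t) powr (b + 1)) \<partial>lborel)
     = (\<integral>\<^sup>+t. ennreal (m powr (b + 1)) * indicator {0<..<1::real} t \<partial>lborel)"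
    using m by (intro nn_integral_cong) (auto simp: indicator_def dist)
  also have "\<dots> = ennreal (m powr (b + 1))"
    by (subst nn_integral_cmult_indicator) auto
  finally show ?thesis
    using b by (simp add: lorentz_p1_norm_def ennreal_mult[symmetric])
qed

lemma S_annulus_indicator_ge:
  assumes b: "-1 < b" "b < 0" and m: "0 < m" "m \<le> disc_height z" and z: "cmod z < 1"
  shows "m powr (b + 1) * (ln (1 / disc_height z) / (2 * pi)) / disc_height z
    \<le> cmod (disc_operator (-1) (S_kernel b 1) (annulus_indicator m) z)"
proof -
  let ?g = "\<lambda>w. if disc_height w < m then disc_height w powr b else 0"
  \<comment> \<open>Essential for a lower bound: the Bochner integral of a function that is not
    integrable is 0 by default.\<close>
  have int: "integrable disc_measure ?g"
  proof (rule integrableI_nonneg)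
    have "(\<integral>\<^sup>+w. ennreal (?g w) \<partial>disc_measure) = (\<integral>\<^sup>+x\<in>{0<..<1}. (if x < m then ennreal (x powr b) else 0) \<partial>lborel)"
      by (subst nn_integral_disc_height[symmetric], measurable) (auto intro!: nn_integral_cong)
    also have "\<dots> \<le> ennreal (m powr (b + 1) / (b + 1))"
      using m b by (intro nn_integral_powr_near_0) auto
    finally show "(\<integral>\<^sup>+w. ennreal (?g w) \<partial>disc_measure) < \<infinity>"
      by (rule le_less_trans) simp
  qed auto
  have "integrable disc_measure (\<lambda>w. cmod (of_real (?g w) / (1 - z * cnj w)))"
    by (intro integrable_norm integrable_cauchy_kernel integrable_of_real int z)
  then have int2: "integrable disc_measure (\<lambda>w. ?g w / cmod (1 - z * cnj w))"
    by (rule iffD1[OF Bochner_Integration.integrable_cong, rotated -1]) (auto simp: norm_divide)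
  let ?I = "\<integral>w. ?g w / cmod (1 - z * cnj w) \<partial>disc_measure"
  have "ennreal (m powr (b + 1) * (ln (1 / disc_height z) / (2 * pi))) \<le> ennreal ?I"
    using nn_integral_annulus_inverse_norm_ge[OF _ m z, of b] b
    by (subst nn_integral_eq_integral[OF int2, symmetric]) auto
  moreover have I0: "0 \<le> ?I" by (intro Bochner_Integration.integral_nonneg) auto
  ultimately have le: "m powr (b + 1) * (ln (1 / disc_height z) / (2 * pi)) \<le> ?I"
    by (simp add: ennreal_le_iff)
  have "(\<integral>w. S_kernel b 1 z w * annulus_indicator m w \<partial>disc_measure) = (\<integral>w. of_real (?g w / cmod (1 - z * cnj w)) \<partial>disc_measure)"
    using z by (intro Bochner_Integration.integral_cong) (auto simp: S_kernel_eq annulus_indicator_def)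
  also have "\<dots> = of_real ?I" by (rule integral_complex_of_real)
  finally have "disc_operator (-1) (S_kernel b 1) (annulus_indicator m) z = of_real (disc_height z powr -1) * of_real ?I"
    by (simp only: disc_operator_def disc_height_def[symmetric])
  then have "cmod (disc_operator (-1) (S_kernel b 1) (annulus_indicator m) z) = disc_height z powr -1 * ?I"
    using I0 by (simp only: norm_mult norm_of_real abs_of_nonneg powr_ge_zero)
  also have "\<dots> = ?I / disc_height z"
    using disc_height_pos[OF z] by (simp add: powr_minus_divide)
  finally have eq: "cmod (disc_operator (-1) (S_kernel b 1) (annulus_indicator m) z) = ?I / disc_height z" .
  show ?thesis
    unfolding eq by (intro divide_right_mono le less_imp_le disc_height_pos z)
qed

text \<open>On the ring \<open>m \<le> h < s\<close> with \<open>m = s / 2\<close>, of measure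
  \<open>s / 2\<close>, the image of the annulus indicator exceeds \<open>t\<close>. The powers of
  \<open>m\<close> cancel against the norm, leaving \<open>L / (4 * pi) \<le> C / (b + 1)\<close>
  with \<open>L = ln (1 / s)\<close>.\<close>

lemma S_unbounded:
  fixes b :: real
  assumes b: "-1 < b" "b < 0"
  shows "\<not> bounded_disc_operator (-1) (S_kernel b 1) (lorentz_p1_norm (1 / (b + 1))) weak_L1_norm"
proof
  assume "bounded_disc_operator (-1) (S_kernel b 1) (lorentz_p1_norm (1 / (b + 1))) weak_L1_norm"
  then obtain C where C: "0 \<le> C" and bound: "\<And>f. f \<in> disc_space (lorentz_p1_norm (1 / (b + 1))) \<Longrightarrow>
      disc_operator (-1) (S_kernel b 1) f \<in> disc_space weak_L1_norm \<and>
      weak_L1_norm (disc_operator (-1) (S_kernel b 1) f) \<le> ennreal C * lorentz_p1_norm (1 / (b + 1)) f"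
    unfolding bounded_disc_operator_def by blast
  \<comment> \<open>Just above the largest value compatible with the bound \<open>C\<close>.\<close>
  define L where "L = 4 * pi * C / (b + 1) + 1"
  have L: "0 < L" using C b by (simp add: L_def add_nonneg_pos)
  define s where "s = exp (- L)"
  have s: "0 < s" "s < 1" using L by (auto simp: s_def)
  define m where "m = s / 2"
  have m: "0 < m" "m < s" "m < 1" using s by (auto simp: m_def)
  have ln_s: "ln (1 / s) = L" by (simp add: s_def ln_div)
  let ?f = "annulus_indicator m"
  let ?S = "disc_operator (-1) (S_kernel b 1) ?f"
  have f_meas: "?f \<in> borel_measurable disc_measure"
    unfolding annulus_indicator_def by measurable
  then have f: "?f \<in> disc_space (lorentz_p1_norm (1 / (b + 1)))"
    using lorentz_p1_norm_annulus_indicator[OF b(1) m(1,3)] by (simp add: disc_space_def)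
  \<comment> \<open>The lower bound of \<open>S_annulus_indicator_ge\<close> with \<open>s\<close>
    in place of the height; it is exceeded strictly at heights below \<open>s\<close>.\<close>
  define t where "t = m powr (b + 1) * (L / (2 * pi)) / s"
  have t: "0 < t" using m L s by (simp add: t_def)
  have S_gt: "t < cmod (?S z)" if z: "cmod z < 1" "m \<le> disc_height z" "disc_height z < s" for z
  proof -
    have h: "0 < disc_height z" using z disc_height_pos by blast
    have "L \<le> ln (1 / disc_height z)"
      unfolding ln_s[symmetric] using h z s by (subst ln_le_cancel_iff) (auto intro: divide_left_mono)
    then have "m powr (b + 1) * (L / (2 * pi)) \<le> m powr (b + 1) * (ln (1 / disc_height z) / (2 * pi))"
      by (intro mult_left_mono divide_right_mono) auto
    moreover have "t < m powr (b + 1) * (L / (2 * pi)) / disc_height z"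
      unfolding t_def using h z m L s by (intro divide_strict_left_mono) auto
    ultimately have "t < m powr (b + 1) * (ln (1 / disc_height z) / (2 * pi)) / disc_height z"
      using h by (meson divide_right_mono less_eq_real_def less_le_trans)
    also have "\<dots> \<le> cmod (?S z)" by (rule S_annulus_indicator_ge[OF b m(1) z(2,1)])
    finally show ?thesis .
  qed
  have S_meas: "?S \<in> borel_measurable disc_measure"
    using bound[OF f] by (simp add: disc_space_def)
  have "ennreal (t * (s / 2)) = ennreal t * emeasure disc_measure {z. cmod z < 1 \<and> disc_height z \<in> {m..<s}}"
    using m s t by (subst emeasure_disc_height) (auto simp: ennreal_mult[symmetric] m_def)
  also have "\<dots> \<le> ennreal t * distribution_fun ?S t"
    unfolding distribution_fun_def
  proof (intro mult_left_mono emeasure_mono)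
    have "{z \<in> space disc_measure. t < cmod (?S z)} \<in> sets disc_measure"
      using S_meas by measurable
    then show "{z \<in> ball 0 1. t < cmod (?S z)} \<in> sets disc_measure" by simp
  qed (use S_gt in auto)
  also have "\<dots> \<le> weak_L1_norm ?S"
    unfolding weak_L1_norm_def using t by (intro SUP_upper) auto
  also have "\<dots> \<le> ennreal C * ennreal (1 / (b + 1) * m powr (b + 1))"
    using bound[OF f] lorentz_p1_norm_annulus_indicator[OF b(1) m(1,3)] by simp
  also have "\<dots> = ennreal (C * (1 / (b + 1) * m powr (b + 1)))"
    using C b by (intro ennreal_mult[symmetric]) auto
  finally have "t * (s / 2) \<le> C * (1 / (b + 1) * m powr (b + 1))"
    using C b by (subst (asm) ennreal_le_iff) auto
  moreover have "t * (s / 2) = m powr (b + 1) * (L / (4 * pi))"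
    using s by (simp add: t_def)
  ultimately have "m powr (b + 1) * (L / (4 * pi)) \<le> m powr (b + 1) * (C / (b + 1))"
    by (simp add: mult_ac)
  then have "L / (4 * pi) \<le> C / (b + 1)"
    by (rule mult_left_le_imp_le) (use m in simp)
  then have "L \<le> 4 * pi * C / (b + 1)"
    by (simp add: pos_divide_le_eq mult_ac)
  then show False by (simp add: L_def)
qed

section \<open>The operator with the holomorphic kernel is bounded\<close>

text \<open>Meant for \<open>g\<close> among the positive and negative parts of \<open>f\<close>;
  \<open>b + 1\<close> undoes the factor \<open>p\<close> in the norm.\<close>

lemma level_norm_le_lorentz_p1_norm:
  fixes g :: "complex \<Rightarrow> real"
  assumes b: "-1 < b" and g: "g \<in> borel_measurable disc_measure" and f: "f \<in> borel_measurable disc_measure"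
    and le: "\<And>w. g w \<le> cmod (f w)"
  shows "level_norm b g \<le> ennreal (b + 1) * lorentz_p1_norm (1 / (b + 1)) f"
proof -
  have size: "level_size g t \<le> enn2real (distribution_fun f t)" for t
  proof -
    have "{w. cmod w < 1 \<and> t < cmod (f w)} \<in> sets disc_measure"
      using f by (intro sets_level) auto
    moreover have "{w. cmod w < 1 \<and> t < g w} \<subseteq> {w. cmod w < 1 \<and> t < cmod (f w)}"
      using le by (auto intro: less_le_trans)
    moreover have "{w \<in> ball 0 1. t < cmod (f w)} = {w. cmod w < 1 \<and> t < cmod (f w)}" by auto
    ultimately show ?thesis
      unfolding level_size_def distribution_fun_def measure_def[symmetric]
      by (simp only: disc_measure.finite_measure_mono)
  qed
  have "level_norm b g \<le> (\<integral>\<^sup>+t\<in>{0<..}. ennreal (enn2real (distribution_fun f t) powr (b + 1)) \<partial>lborel)"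
    unfolding level_norm_def using b size
    by (intro nn_integral_mono mult_right_mono ennreal_leI powr_mono2) (auto simp: level_size_def)
  also have "\<dots> = ennreal (b + 1) * lorentz_p1_norm (1 / (b + 1)) f"
    using b by (simp add: lorentz_p1_norm_def mult.assoc[symmetric] ennreal_mult[symmetric])
  finally show ?thesis .
qed

lemma T_kernel_eq:
  "T_kernel b 1 z w = of_real (disc_height w powr b) / (1 - z * cnj w)" if "cmod z < 1" "cmod w < 1"
proof -
  have "1 - z * cnj w \<noteq> 0" using norm_mult_cnj_less_1[OF that] by auto
  then show ?thesis by (simp add: T_kernel_def disc_height_def)
qed

lemma T_bounded:
  fixes b :: real
  assumes b: "-1 < b" "b < 0"
  shows "bounded_disc_operator (-1) (T_kernel b 1) (lorentz_p1_norm (1 / (b + 1))) weak_L1_norm"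
proof -
  obtain C where C: "0 \<le> C" and weak: "\<And>g \<mu>. g \<in> borel_measurable disc_measure \<Longrightarrow> level_norm b g < \<infinity> \<Longrightarrow>
      (\<And>w. 0 \<le> g w) \<Longrightarrow> 0 < \<mu> \<Longrightarrow> ennreal \<mu> * emeasure disc_measure
          {z. cmod z < 1 \<and> \<mu> * disc_height z < cmod (cauchy_transform (\<lambda>w. of_real (g w * disc_height w powr b)) z)}
        \<le> ennreal C * level_norm b g"
    using cauchy_transform_weak_type[OF b] by blast
  show ?thesis
    unfolding bounded_disc_operator_def
  proof (intro exI conjI ballI)
    show "0 \<le> 16 * (C * (b + 1))" using C b by simp
  next
    fix f assume "f \<in> disc_space (lorentz_p1_norm (1 / (b + 1)))"
    then have f [measurable]: "f \<in> borel_measurable disc_measure"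
      and fin: "lorentz_p1_norm (1 / (b + 1)) f < \<infinity>"
      by (auto simp: disc_space_def)
    let ?N = "lorentz_p1_norm (1 / (b + 1)) f"
    \<comment> \<open>The weak type bound asks for nonnegative densities, so \<open>f\<close> is cut
      into four, indexed by numbers so that the estimates become sums over
      \<open>j < 4\<close>.\<close>
    define p where "p j w = max 0 (if j = (0::nat) then Re (f w) else if j = 1 then - Re (f w)
        else if j = 2 then Im (f w) else - Im (f w))" for j w
    have p_meas [measurable]: "p j \<in> borel_measurable disc_measure" for j
      unfolding p_def by measurable
    have p_nonneg: "0 \<le> p j w" for j w by (simp add: p_def)
    have p_le: "p j w \<le> cmod (f w)" for j w
      using abs_Re_le_cmod[of "f w"] abs_Im_le_cmod[of "f w"] by (auto simp: p_def)
    have f_eq: "f w = of_real (p 0 w) - of_real (p 1 w) + \<i> * (of_real (p 2 w) - of_real (p 3 w))" for w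
      by (auto simp: p_def complex_eq_iff)
    have norm_p: "level_norm b (p j) \<le> ennreal (b + 1) * ?N" for j
      by (rule level_norm_le_lorentz_p1_norm[OF b(1) p_meas f p_le])
    have fin_p: "level_norm b (p j) < \<infinity>" for j
      using le_less_trans[OF norm_p[of j]] fin by (simp add: ennreal_mult_less_top)
    define G where "G j = cauchy_transform (\<lambda>w. of_real (p j w * disc_height w powr b))" for j
    have int: "integrable disc_measure (\<lambda>w. of_real (p j w * disc_height w powr b) :: complex)" for j
      by (intro integrable_of_real integrable_height_powr b p_meas fin_p p_nonneg)
    have G_meas [measurable]: "G j \<in> borel_measurable disc_measure" for j
      unfolding G_def
      by (intro measurable_disc_measure_continuous_on holomorphic_on_imp_continuous_on holomorphic_cauchy_transform int)
    let ?k = "\<lambda>z j w. of_real (p j w * disc_height w powr b) / (1 - z * cnj w) :: complex"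
    have kernel: "T_kernel b 1 z w * f w = ?k z 0 w - ?k z 1 w + \<i> * (?k z 2 w - ?k z 3 w)"
      if "cmod z < 1" "cmod w < 1" for z w
      unfolding T_kernel_eq[OF that] by (subst f_eq) (simp add: algebra_simps add_divide_distrib diff_divide_distrib)
    have int_k: "integrable disc_measure (?k z j)" if "cmod z < 1" for z j
      by (rule integrable_cauchy_kernel[OF int that])
    have has: "has_bochner_integral disc_measure (\<lambda>w. T_kernel b 1 z w * f w) (G 0 z - G 1 z + \<i> * (G 2 z - G 3 z))"
      if z: "cmod z < 1" for z
    proof -
      have k: "has_bochner_integral disc_measure (?k z j) (G j z)" for j
        unfolding G_def cauchy_transform_def by (rule has_bochner_integral_integrable[OF int_k[OF z]])
      have "has_bochner_integral disc_measure (\<lambda>w. ?k z 0 w - ?k z 1 w + \<i> * (?k z 2 w - ?k z 3 w))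
          (G 0 z - G 1 z + \<i> * (G 2 z - G 3 z))"
        by (intro has_bochner_integral_add has_bochner_integral_diff has_bochner_integral_mult_right k)
      then show ?thesis
        by (subst has_bochner_integral_cong[OF refl _ refl]) (auto simp: kernel[OF z])
    qed
    show "AE z in disc_measure. integrable disc_measure (\<lambda>w. T_kernel b 1 z w * f w)"
      using has by (intro AE_I2) (auto intro: integrable.intros)
    let ?T = "disc_operator (-1) (T_kernel b 1) f"
    have T_eq: "?T z = of_real (disc_height z powr -1) * (G 0 z - G 1 z + \<i> * (G 2 z - G 3 z))" if "cmod z < 1" for z
      unfolding disc_operator_def disc_height_def[symmetric]
      by (simp only: has_bochner_integral_integral_eq[OF has[OF that]])
    have T_meas: "?T \<in> borel_measurable disc_measure"
    proof (subst measurable_cong)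
      show "?T z = of_real (disc_height z powr -1) * (G 0 z - G 1 z + \<i> * (G 2 z - G 3 z))" if "z \<in> space disc_measure" for z
        using that by (intro T_eq) simp
    qed measurable
    have weak_T: "weak_L1_norm ?T \<le> ennreal (16 * (C * (b + 1))) * ?N"
      unfolding weak_L1_norm_def
    proof (rule SUP_least)
      fix t :: real assume "t \<in> {0<..}"
      then have t: "0 < t" by simp
      define A where "A j = {z. cmod z < 1 \<and> t / 4 * disc_height z < cmod (G j z)}" for j
      have A_sets: "A j \<in> sets disc_measure" for j
      proof -
        have "{z \<in> space disc_measure. t / 4 * disc_height z < cmod (G j z)} \<in> sets disc_measure"
          by measurable
        then show ?thesis by (simp add: A_def)
      qed
      have A_le: "ennreal t * emeasure disc_measure (A j) \<le> ennreal (4 * (C * (b + 1))) * ?N" for j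
      proof -
        have "ennreal t * emeasure disc_measure (A j) = ennreal 4 * (ennreal (t / 4) * emeasure disc_measure (A j))"
          using t by (simp only: mult.assoc[symmetric], subst ennreal_mult[symmetric]) auto
        also have "\<dots> \<le> ennreal 4 * (ennreal C * level_norm b (p j))"
          unfolding A_def G_def using t by (intro mult_left_mono weak p_meas fin_p p_nonneg) auto
        also have "\<dots> \<le> ennreal 4 * (ennreal C * (ennreal (b + 1) * ?N))"
          by (intro mult_left_mono norm_p) auto
        also have "\<dots> = ennreal (4 * (C * (b + 1))) * ?N"
        proof -
          have "ennreal (4 * (C * (b + 1))) = ennreal 4 * (ennreal C * ennreal (b + 1))"
            using C b by (subst ennreal_mult) (auto simp: ennreal_mult)
          then show ?thesis by (simp only: mult.assoc)
        qed
        finally show ?thesis .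
      qed
      \<comment> \<open>Pigeonhole: if four moduli add up to more than
        \<open>t * disc_height z\<close>, one of them exceeds a quarter of it.\<close>
      have "{z \<in> ball 0 1. t < cmod (?T z)} \<subseteq> (\<Union>j<4. A j)"
      proof
        fix z assume "z \<in> {z \<in> ball 0 1. t < cmod (?T z)}"
        then have z: "cmod z < 1" and tT: "t < cmod (?T z)" by auto
        have h: "0 < disc_height z" by (rule disc_height_pos[OF z])
        have "cmod (G 0 z - G 1 z + \<i> * (G 2 z - G 3 z)) \<le> cmod (G 0 z - G 1 z) + cmod (\<i> * (G 2 z - G 3 z))"
          by (rule norm_triangle_ineq)
        also have "\<dots> \<le> (cmod (G 0 z) + cmod (G 1 z)) + (cmod (G 2 z) + cmod (G 3 z))"
          by (intro add_mono) (auto simp: norm_mult norm_triangle_ineq4)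
        finally have le: "cmod (G 0 z - G 1 z + \<i> * (G 2 z - G 3 z)) \<le> (\<Sum>j<4. cmod (G j z))"
          by (simp add: eval_nat_numeral)
        have "t * disc_height z < cmod (?T z) * disc_height z"
          using tT h by (rule mult_strict_right_mono)
        also have "\<dots> = cmod (G 0 z - G 1 z + \<i> * (G 2 z - G 3 z))"
          unfolding T_eq[OF z] norm_mult using h by (simp add: powr_minus_divide norm_divide)
        finally have "(\<Sum>j<(4::nat). t / 4 * disc_height z) < (\<Sum>j<4. cmod (G j z))"
          using le by simp
        then obtain j where "j < 4" "t / 4 * disc_height z < cmod (G j z)"
          by (meson lessThan_iff not_less sum_mono)
        then show "z \<in> (\<Union>j<4. A j)" using z by (auto simp: A_def)
      qed
      then have "distribution_fun ?T t \<le> emeasure disc_measure (\<Union>j<4. A j)"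
        unfolding distribution_fun_def using A_sets by (intro emeasure_mono) auto
      also have "\<dots> \<le> (\<Sum>j<4. emeasure disc_measure (A j))"
        using A_sets by (intro emeasure_subadditive_finite) auto
      finally have "ennreal t * distribution_fun ?T t \<le> ennreal t * (\<Sum>j<4. emeasure disc_measure (A j))"
        by (rule mult_left_mono) simp
      also have "\<dots> = (\<Sum>j<4. ennreal t * emeasure disc_measure (A j))"
        by (rule sum_distrib_left)
      also have "\<dots> \<le> (\<Sum>j<(4::nat). ennreal (4 * (C * (b + 1))) * ?N)"
        by (intro sum_mono A_le)
      also have "\<dots> = ennreal (16 * (C * (b + 1))) * ?N"
      proof -
        have "ennreal (16 * (C * (b + 1))) = ennreal 4 * ennreal (4 * (C * (b + 1)))"
          using C b by (subst ennreal_mult[symmetric]) auto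
        then show ?thesis by (simp add: mult.assoc)
      qed
      finally show "ennreal t * distribution_fun ?T t \<le> ennreal (16 * (C * (b + 1))) * ?N" .
    qed
    then show "weak_L1_norm ?T \<le> ennreal (16 * (C * (b + 1))) * ?N" .
    show "?T \<in> disc_space weak_L1_norm"
      using T_meas le_less_trans[OF weak_T] fin by (simp add: disc_space_def ennreal_mult_less_top)
  qed
qed

theorem theorem11p6:
  fixes b c :: real
  assumes "b > -1" and "0 \<le> 2 - c + b" and "2 - c + b < 1" and "c = 1"
  shows "\<not> bounded_disc_operator (-1) (S_kernel b c) (lorentz_p1_norm (1 / (b + 1))) weak_L1_norm
       \<and> bounded_disc_operator (-1) (T_kernel b c) (lorentz_p1_norm (1 / (b + 1))) weak_L1_norm"
  \<comment> \<open>For \<open>c = 1\<close> the bound \<open>2 - c + b < 1\<close> says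
    \<open>b < 0\<close>, that is \<open>p > 1\<close>, which leaves room for
    \<open>q\<close>.\<close>
  using assms S_unbounded[of b] T_bounded[of b] by simp

end
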